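(* There exists a polynomial time $\frac{6e-5}{6e+5}$-approximation algorithm for OPT-EXT(0,1).
   Context: An instance of OPT-EXT(0,1) consists of an undirected graph $G=(V,E)$, a set $O$ of objects with $|O| = |V|$, and a valuation $val: O\to\{0,1\}$. An allocation is a bijection $\pi: V\to O$. Under $\pi$, the externality of a vertex $v$ is $ext_\pi(v)=1$ if $val(\pi(v))=0$ and some neighbor $u$ of $v$ has $val(\pi(u))=1$, and $ext_\pi(v)=0$ otherwise. The total externality is $Ext_\pi(G)=\sum_{v\in V} ext_\pi(v)$. OPT-EXT(0,1) asks for an allocation $\pi$ maximizing $Ext_\pi(G)$; a $\rho$-approximation algorithm outputs an allocation with value at least $\rho$ times the optimum. *)

theory Defs
  imports Complex_Main "HOL-Computational_Algebra.Polynomial"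
begin

section \<open>The problem OPT-EXT(0,1)\<close>

definition opt_ext_instance ::
    "'v set \<Rightarrow> 'v set set \<Rightarrow> 'o set \<Rightarrow> ('o \<Rightarrow> nat) \<Rightarrow> bool" where
  "opt_ext_instance V E Ob val \<longleftrightarrow>
     finite V \<and> (\<forall>e\<in>E. e \<subseteq> V \<and> card e = 2) \<and>
     finite Ob \<and> card Ob = card V \<and> (\<forall>x\<in>Ob. val x \<in> {0, 1})"

definition allocation :: "'v set \<Rightarrow> 'o set \<Rightarrow> ('v \<Rightarrow> 'o) \<Rightarrow> bool" where
  "allocation V Ob \<pi> \<longleftrightarrow> bij_betw \<pi> V Ob"

definition ext ::
    "'v set set \<Rightarrow> ('o \<Rightarrow> nat) \<Rightarrow> ('v \<Rightarrow> 'o) \<Rightarrow> 'v \<Rightarrow> nat" where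
  "ext E val \<pi> v =
     (if val (\<pi> v) = 0 \<and> (\<exists>u. {u, v} \<in> E \<and> val (\<pi> u) = 1) then 1 else 0)"

definition total_ext ::
    "'v set \<Rightarrow> 'v set set \<Rightarrow> ('o \<Rightarrow> nat) \<Rightarrow> ('v \<Rightarrow> 'o) \<Rightarrow> nat" where
  "total_ext V E val \<pi> = (\<Sum>v\<in>V. ext E val \<pi> v)"

definition opt_ext ::
    "'v set \<Rightarrow> 'v set set \<Rightarrow> 'o set \<Rightarrow> ('o \<Rightarrow> nat) \<Rightarrow> nat" where
  "opt_ext V E Ob val = Max {total_ext V E val \<pi> | \<pi>. allocation V Ob \<pi>}"

section \<open>Random access machines\<close>

text \<open>
  The machine has registers and a memory, both holding natural numbers; every
  instruction and every test takes one unit of time. Addition and truncated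
  subtraction are the only arithmetic, so in \<open>t\<close> steps a number grows by at
  most \<open>t\<close> bits beyond the constants of the program and the input. Hence
  polynomial time here is polynomial time on Turing machines; this would fail
  for unit-cost multiplication.
\<close>

datatype ram =
    Skip
  | Const nat nat
  | Add nat nat nat
  | Sub nat nat nat
  | Load nat nat
  | Store nat nat
  | Seq ram ram
  | IfNZ nat ram ram
  | WhileNZ nat ram

type_synonym ram_state = "(nat \<Rightarrow> nat) \<times> (nat \<Rightarrow> nat)"

inductive exec :: "ram \<Rightarrow> ram_state \<Rightarrow> nat \<Rightarrow> ram_state \<Rightarrow> bool" where
  Skip: "exec Skip s 1 s"
| Const: "exec (Const a k) (r, m) 1 (r(a := k), m)"
| Add: "exec (Add a b c) (r, m) 1 (r(a := r b + r c), m)"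
| Sub: "exec (Sub a b c) (r, m) 1 (r(a := r b - r c), m)"
| Load: "exec (Load a b) (r, m) 1 (r(a := m (r b)), m)"
| Store: "exec (Store a b) (r, m) 1 (r, m(r a := r b))"
| Seq: "exec p s t s' \<Longrightarrow> exec q s' t' s'' \<Longrightarrow> exec (Seq p q) s (t + t') s''"
| IfTrue: "fst s a \<noteq> 0 \<Longrightarrow> exec p s t s' \<Longrightarrow> exec (IfNZ a p q) s (t + 1) s'"
| IfFalse: "fst s a = 0 \<Longrightarrow> exec q s t s' \<Longrightarrow> exec (IfNZ a p q) s (t + 1) s'"
| WhileFalse: "fst s a = 0 \<Longrightarrow> exec (WhileNZ a p) s 1 s"
| WhileTrue: "fst s a \<noteq> 0 \<Longrightarrow> exec p s t s' \<Longrightarrow> exec (WhileNZ a p) s' t' s'' \<Longrightarrow>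
    exec (WhileNZ a p) s (t + t' + 1) s''"

inductive_cases exec_basicEs:
  "exec Skip s t s'"
  "exec (Const a k) s t s'"
  "exec (Add a b c) s t s'"
  "exec (Sub a b c) s t s'"
  "exec (Load a b) s t s'"
  "exec (Store a b) s t s'"
inductive_cases exec_SeqE: "exec (Seq p q) s t s'"
inductive_cases exec_IfE: "exec (IfNZ a p q) s t s'"
inductive_cases exec_WhileE: "exec (WhileNZ a p) s t s'"

lemma exec_deterministic:
  "exec p s t s' \<Longrightarrow> exec p s u s'' \<Longrightarrow> t = u \<and> s' = s''"
proof (induction arbitrary: u s'' rule: exec.induct)
  case (Seq p s t s' q t' s2)
  from Seq.prems obtain t1 s1 t2 where
    *: "u = t1 + t2" "exec p s t1 s1" "exec q s1 t2 s''" by (rule exec_SeqE)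
  from Seq.IH(1)[OF *(2)] have "t = t1" "s' = s1" by simp_all
  with Seq.IH(2)[of t2 s''] * show ?case by simp
next
  case (IfTrue s a p t s' q)
  from IfTrue.prems obtain t1 where
    "u = t1 + 1" "exec p s t1 s''" by (rule exec_IfE) (use IfTrue.hyps in simp_all)
  with IfTrue.IH[of t1 s''] show ?case by simp
next
  case (IfFalse s a q t s' p)
  from IfFalse.prems obtain t1 where
    "u = t1 + 1" "exec q s t1 s''" by (rule exec_IfE) (use IfFalse.hyps in simp_all)
  with IfFalse.IH[of t1 s''] show ?case by simp
next
  case (WhileFalse s a p)
  from WhileFalse.prems show ?case by (rule exec_WhileE) (use WhileFalse.hyps in simp_all)
next
  case (WhileTrue s a p t s' t' s2)
  from WhileTrue.prems obtain t1 s1 t2 where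
    *: "u = t1 + t2 + 1" "exec p s t1 s1" "exec (WhileNZ a p) s1 t2 s''"
    by (rule exec_WhileE) (use WhileTrue.hyps(1) in simp_all)
  from WhileTrue.IH(1)[OF *(2)] have "t = t1" "s' = s1" by simp_all
  with WhileTrue.IH(2)[of t2 s''] * show ?case by simp
qed (auto elim: exec_basicEs)

definition init_state :: "nat list \<Rightarrow> ram_state" where
  "init_state x = ((\<lambda>_. 0), (\<lambda>i. if i < length x then x ! i else 0))"

definition polynomial_time_on :: "nat list set \<Rightarrow> ram \<Rightarrow> bool" where
  "polynomial_time_on X p \<longleftrightarrow>
     (\<exists>b :: nat poly. \<forall>x\<in>X. \<exists>t s. exec p (init_state x) t s \<and> t \<le> poly b (length x))"

section \<open>Algorithms for OPT-EXT(0,1)\<close>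

text \<open>
  An instance is presented to the machine relative to listings \<open>vs\<close> of the
  vertices and \<open>os\<close> of the objects: the number of vertices, the values of the
  objects, and the rows of the adjacency matrix. All entries but the first are
  0 or 1, so the length of the list is polynomially related to its size in bits.
\<close>

definition listings :: "'v set \<Rightarrow> 'o set \<Rightarrow> 'v list \<Rightarrow> 'o list \<Rightarrow> bool" where
  "listings V Ob vs os \<longleftrightarrow> distinct vs \<and> set vs = V \<and> distinct os \<and> set os = Ob"

definition encode_instance ::
    "'v set set \<Rightarrow> ('o \<Rightarrow> nat) \<Rightarrow> 'v list \<Rightarrow> 'o list \<Rightarrow> nat list" where
  "encode_instance E val vs os =
     length vs # map val os @
     concat (map (\<lambda>u. map (\<lambda>v. if {u, v} \<in> E then 1 else 0) vs) vs)"

text \<open>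
  The answer is read off the memory: cell \<open>i\<close> holds the position in \<open>os\<close> of the
  object allocated to the \<open>i\<close>-th vertex.
\<close>

definition encodes_allocation ::
    "'v list \<Rightarrow> 'o list \<Rightarrow> (nat \<Rightarrow> nat) \<Rightarrow> ('v \<Rightarrow> 'o) \<Rightarrow> bool" where
  "encodes_allocation vs os m \<pi> \<longleftrightarrow>
     (\<forall>i < length vs. m i < length os \<and> \<pi> (vs ! i) = os ! m i)"

definition opt_ext_inputs :: "nat list set" where
  "opt_ext_inputs =
     {encode_instance E val vs os | (V :: nat set) E (Ob :: nat set) val vs os.
        opt_ext_instance V E Ob val \<and> listings V Ob vs os}"

definition opt_ext_approximation :: "real \<Rightarrow> ram \<Rightarrow> bool" where
  "opt_ext_approximation \<rho> p \<longleftrightarrow>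
     (\<forall>(V :: nat set) E (Ob :: nat set) val vs os.
        opt_ext_instance V E Ob val \<longrightarrow> listings V Ob vs os \<longrightarrow>
        (\<exists>t r m \<pi>. exec p (init_state (encode_instance E val vs os)) t (r, m) \<and>
           encodes_allocation vs os m \<pi> \<and> allocation V Ob \<pi> \<and>
           real (total_ext V E val \<pi>) \<ge> \<rho> * real (opt_ext V E Ob val)))"

end

theory Submission
  imports Defs "HOL-Analysis.Complex_Transcendental"
begin

text \<open>
  Let \<open>k\<close> be the number of objects of value 1. If a set \<open>C\<close> of at most \<open>k\<close> vertices dominates
  \<open>d\<close> vertices outside itself (its leaves), the remaining ones can be put on undominated vertices
  first and on leaves last, which gives total externality at least \<open>min d (n - k)\<close>; so it suffices
  to approximate the maximum \<open>l\<close> of \<open>d\<close>. The algorithm is a local search from the empty set that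
  maximizes \<open>d\<close>, and subject to that minimizes \<open>card C\<close>. It applies the best single insertion or
  deletion while one improves, and otherwise an improving pair of such changes.

  Compare with an optimal star forest with \<open>c\<close> centers and \<open>l\<close> leaves. If \<open>C\<close> with its leaves
  covers fewer than \<open>l + c - m * c\<close> vertices, then some center gains \<open>m\<close> leaves when inserted.
  Integrality of these gains bounds the greedy phase when \<open>7/4 c \<le> l \<le> 5 c\<close>, and the usual
  \<open>1 - 1/e\<close> estimate does when \<open>l \<ge> 5 c\<close>. When \<open>l < 7/4 c\<close>, local optimality suffices: every
  member of \<open>C\<close> has a leaf of its own, so \<open>d \<ge> card C\<close>, and if \<open>card C < k\<close> then exchanging a member
  for its only own leaf is unprofitable, which yields \<open>4 d \<ge> 2 l + c\<close>. Each case gives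
  \<open>d \<ge> 0.531 l\<close>, and \<open>(6 e - 5) / (6 e + 5) < 0.531\<close>.
\<close>

section \<open>Local search for star forests\<close>

locale finite_graph =
  fixes V :: "'a set" and adj :: "'a \<Rightarrow> 'a \<Rightarrow> bool"
  assumes finite_V: "finite V"
    and adj_V: "adj u v \<Longrightarrow> u \<in> V"
    and adj_sym: "adj u v \<Longrightarrow> adj v u"
    and adj_irrefl: "\<not> adj u u"
begin

section \<open>Leaves, toggles and a lexicographic score\<close>

definition leaves :: "'a set \<Rightarrow> 'a set" where
  "leaves C = {v \<in> V - C. \<exists>u\<in>C. adj u v}"

definition undominated :: "'a set \<Rightarrow> 'a set" where
  "undominated C = V - C - leaves C"

definition toggle :: "'a \<Rightarrow> 'a set \<Rightarrow> 'a set" where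
  "toggle x C = (if x \<in> C then C - {x} else insert x C)"

text \<open>One number encodes the lexicographic goal: since
  \<open>card (V - C) \<le> card V\<close>, a single leaf outweighs the second term, which then
  favours the smaller set. Sets with more than \<open>k\<close> vertices get 0. \<open>C\<close> may
  contain non-vertices because the program uses one as a dummy.\<close>

definition score :: "nat \<Rightarrow> 'a set \<Rightarrow> nat" where
  "score k C =
     (if card (C \<inter> V) \<le> k then (card V + 1) * card (leaves C) + card (V - C) else 0)"

lemma leaves_Int: "leaves (C \<inter> V) = leaves C"
  using adj_V by (auto simp: leaves_def)

lemma score_Int: "score k (C \<inter> V) = score k C"
proof -
  have "C \<inter> V \<inter> V = C \<inter> V" "V - C \<inter> V = V - C" by auto
  then show ?thesis by (simp add: score_def leaves_Int)
qed

lemma toggle_Int: "x \<in> V \<Longrightarrow> toggle x C \<inter> V = toggle x (C \<inter> V)"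
  by (auto simp: toggle_def)

lemma toggle_Int_outside: "x \<notin> V \<Longrightarrow> toggle x C \<inter> V = C \<inter> V"
  by (auto simp: toggle_def)

lemma score_cong: "C \<inter> V = C' \<inter> V \<Longrightarrow> score k C = score k C'"
  by (metis score_Int)

text \<open>A non-vertex acts as a dummy partner that turns a pair of toggles into a single
  one.\<close>

lemma score_toggle_outside:
  assumes "x \<notin> V"
  shows "score k (toggle v (toggle x C)) = score k (toggle v C)"
proof (rule score_cong)
  show "toggle v (toggle x C) \<inter> V = toggle v C \<inter> V"
    using toggle_Int_outside[OF assms] by (cases "v \<in> V") (auto simp: toggle_Int toggle_Int_outside)
qed

lemma toggle_toggle [simp]: "toggle x (toggle x C) = C"
  by (auto simp: toggle_def)

lemma finite_leaves [simp]: "finite (leaves C)"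
  using finite_V by (simp add: leaves_def)

lemma finite_undominated [simp]: "finite (undominated C)"
  using finite_V by (simp add: undominated_def)

lemma finite_sub_V: "C \<subseteq> V \<Longrightarrow> finite C"
  using finite_V finite_subset by blast

lemma card_cover:
  assumes "C \<subseteq> V"
  shows "card (C \<union> leaves C) = card C + card (leaves C)"
proof -
  have "C \<inter> leaves C = {}" by (auto simp: leaves_def)
  then show ?thesis using card_Un_disjoint[of C "leaves C"] finite_sub_V[OF assms] by simp
qed

lemma card_cover_le:
  assumes "C \<subseteq> V"
  shows "card C + card (leaves C) \<le> card V"
proof -
  have "C \<union> leaves C \<subseteq> V" using assms by (auto simp: leaves_def)
  then show ?thesis using card_mono[OF finite_V] card_cover[OF assms] by metis
qed

text \<open>Adding \<open>card C\<close> replaces \<open>card (V - C)\<close> by the constant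
  \<open>card V\<close> and avoids truncated subtraction.\<close>

lemma score_eq:
  assumes "C \<subseteq> V" "card C \<le> k"
  shows "score k C + card C = (card V + 1) * card (leaves C) + card V"
proof -
  have "C \<inter> V = C" using assms by auto
  moreover have "card (V - C) + card C = card V"
    using card_Diff_subset[OF finite_sub_V[OF assms(1)] assms(1)] card_mono[OF finite_V assms(1)]
    by simp
  ultimately show ?thesis using assms by (simp add: score_def)
qed

lemma score_le_imp_leaves_le:
  assumes "C \<subseteq> V" "C' \<subseteq> V" "card C \<le> k" "card C' \<le> k"
    and le: "score k C \<le> score k C'"
  shows "card (leaves C) \<le> card (leaves C')"
proof (rule ccontr)
  assume "\<not> ?thesis"
  then have "card (leaves C') + 1 \<le> card (leaves C)" by simp
  from mult_le_mono2[OF this, of "card V + 1"]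
  have "(card V + 1) * card (leaves C') + (card V + 1) \<le> (card V + 1) * card (leaves C)"
    by simp
  moreover have "card C \<le> card V" using card_mono[OF finite_V assms(1)] .
  ultimately show False using score_eq[OF assms(1,3)] score_eq[OF assms(2,4)] le by linarith
qed

lemma score_less_if_leaves_less:
  assumes "C \<subseteq> V" "C' \<subseteq> V" "card C \<le> k" "card C' \<le> k"
    and less: "card (leaves C) < card (leaves C')"
  shows "score k C < score k C'"
proof -
  from less have "card (leaves C) + 1 \<le> card (leaves C')" by simp
  from mult_le_mono2[OF this, of "card V + 1"]
  have "(card V + 1) * card (leaves C) + (card V + 1) \<le> (card V + 1) * card (leaves C')"
    by simp
  moreover have "card C' \<le> card V" using card_mono[OF finite_V assms(2)] .
  ultimately show ?thesis using score_eq[OF assms(1,3)] score_eq[OF assms(2,4)] by linarith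
qed

lemma score_less_if_smaller:
  assumes "C \<subseteq> V" "C' \<subseteq> V" "card C \<le> k" "card C' < card C"
    and le: "card (leaves C) \<le> card (leaves C')"
  shows "score k C < score k C'"
proof -
  from mult_le_mono2[OF le, of "card V + 1"]
  have "(card V + 1) * card (leaves C) \<le> (card V + 1) * card (leaves C')" .
  moreover have "card C' \<le> k" using assms by simp
  ultimately show ?thesis using score_eq[OF assms(1,3)] score_eq[OF assms(2)] assms(4)
    by fastforce
qed

section \<open>Star forests and the averaging argument\<close>

definition star_forest :: "'a set \<Rightarrow> 'a set \<Rightarrow> ('a \<Rightarrow> 'a) \<Rightarrow> bool" where
  "star_forest A T f \<longleftrightarrow> A \<inter> T = {} \<and> f ` T = A \<and> (\<forall>t\<in>T. adj (f t) t)"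

lemma star_forestD:
  assumes "star_forest A T f"
  shows "A \<subseteq> V" "T \<subseteq> V" "finite A" "finite T" "card (A \<union> T) = card A + card T"
    "card A \<le> card T"
proof -
  show 1: "A \<subseteq> V" "T \<subseteq> V"
    using assms adj_V adj_V[OF adj_sym] by (auto simp: star_forest_def)
  then show 2: "finite A" "finite T" using finite_sub_V by auto
  show "card (A \<union> T) = card A + card T"
    using assms 2 by (simp add: star_forest_def card_Un_disjoint)
  show "card A \<le> card T"
    using assms 2 card_image_le[of T f] by (auto simp: star_forest_def)
qed

text \<open>Averaging: more than \<open>m * card A\<close> of the \<open>card T + card A\<close>
  forest vertices are undominated, so one star contains at least \<open>m + 1\<close> of them.
  Inserting its center enlarges the cover by \<open>m + 1\<close> and the set by one vertex, so the
  number of leaves grows by \<open>m\<close>.\<close>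

lemma star_gain:
  assumes sf: "star_forest A T f" and C: "C \<subseteq> V"
    and less: "card C + card (leaves C) + m * card A < card T + card A"
  shows "\<exists>s\<in>V - C. card (leaves C) + m \<le> card (leaves (insert s C))"
proof -
  \<comment> \<open>The part of the star at \<open>s\<close>, center included, that \<open>C\<close>
    misses.\<close>
  define W where "W s = ({s} \<union> {t\<in>T. f t = s}) \<inter> undominated C" for s
  have AT: "A \<union> T \<subseteq> V" using star_forestD[OF sf] by auto
  have "A \<union> T \<subseteq> (C \<union> leaves C) \<union> (\<Union>s\<in>A. W s)"
    using AT sf by (auto simp: W_def undominated_def star_forest_def)
  moreover have finW: "finite (W s)" for s by (simp add: W_def)
  moreover have finA: "finite A" using star_forestD[OF sf] by auto
  ultimately have "card (A \<union> T) \<le> card ((C \<union> leaves C) \<union> (\<Union>s\<in>A. W s))"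
    using finite_sub_V[OF C] by (intro card_mono) auto
  also have "\<dots> \<le> card (C \<union> leaves C) + card (\<Union>s\<in>A. W s)" by (rule card_Un_le)
  also have "\<dots> \<le> card (C \<union> leaves C) + (\<Sum>s\<in>A. card (W s))"
    using card_UN_le[OF finA] by simp
  finally have "m * card A < (\<Sum>s\<in>A. card (W s))"
    using less star_forestD(5)[OF sf] card_cover[OF C] by simp
  then have "\<exists>s\<in>A. m < card (W s)"
    using sum_bounded_above[of A "\<lambda>s. card (W s)" m] by (force simp: mult.commute)
  then obtain s where s: "s \<in> A" "m < card (W s)" by auto
  then obtain w where w: "w \<in> W s" by (metis card.empty equals0I not_less0)
  have sV: "s \<in> V" using s star_forestD[OF sf] by auto
  have adjW: "v = s \<or> adj s v" if "v \<in> W s" for v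
    using that sf by (auto simp: W_def star_forest_def)
  \<comment> \<open>If \<open>s\<close> were in \<open>C\<close>, the undominated \<open>w\<close>
    would be a member or a leaf.\<close>
  have sC: "s \<notin> C"
    using adjW[OF w] w C by (auto simp: W_def undominated_def leaves_def)
  have "C \<union> leaves C \<union> W s \<subseteq> insert s C \<union> leaves (insert s C)"
    using adjW by (auto simp: leaves_def undominated_def W_def)
  then have "card (C \<union> leaves C \<union> W s) \<le> card (insert s C \<union> leaves (insert s C))"
    using finite_sub_V[OF C] by (intro card_mono) auto
  moreover have "card (C \<union> leaves C \<union> W s) = card (C \<union> leaves C) + card (W s)"
    using finite_sub_V[OF C] finW by (intro card_Un_disjoint) (auto simp: W_def undominated_def)
  moreover have "card (insert s C \<union> leaves (insert s C)) = card C + 1 + card (leaves (insert s C))"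
    using card_cover[of "insert s C"] sV C sC finite_sub_V[OF C] by simp
  ultimately have "card (leaves C) + m \<le> card (leaves (insert s C))"
    using s card_cover[OF C] by simp
  then show ?thesis using sV sC by auto
qed

section \<open>Bounds from local optimality\<close>

definition locally_optimal :: "nat \<Rightarrow> 'a set \<Rightarrow> bool" where
  "locally_optimal k C \<longleftrightarrow> (\<forall>x\<in>V. score k (toggle x C) \<le> score k C) \<and>
     (\<forall>x\<in>V. \<forall>y\<in>V. score k (toggle x (toggle y C)) \<le> score k C)"

text \<open>For \<open>u\<close> in \<open>C\<close> these are its private neighbours: the leaves
  that lose their last neighbour in the set when \<open>u\<close> is deleted.\<close>

definition own_leaves :: "'a set \<Rightarrow> 'a \<Rightarrow> 'a set" where
  "own_leaves C u = {v \<in> leaves C. \<forall>w\<in>C. adj w v \<longrightarrow> w = u}"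

context
  fixes C k
  assumes C: "C \<subseteq> V" "card C \<le> k" and opt: "locally_optimal k C"
begin

lemma finite_C: "finite C"
  using C finite_sub_V by auto

lemma no_gain_insert:
  assumes "card C < k" "z \<in> V" "z \<notin> C"
  shows "card (leaves (insert z C)) \<le> card (leaves C)"
proof (rule ccontr)
  assume "\<not> ?thesis"
  then have "score k C < score k (insert z C)"
    using assms C finite_C by (intro score_less_if_leaves_less) auto
  moreover have "insert z C = toggle z C" using assms by (simp add: toggle_def)
  ultimately show False using opt assms by (simp add: locally_optimal_def leD)
qed

text \<open>Otherwise deleting \<open>u\<close> keeps every leaf and shrinks the set, which raises
  the score.\<close>

lemma own_leaves_nonempty:
  assumes "u \<in> C"
  shows "own_leaves C u \<noteq> {}"
proof
  assume empty: "own_leaves C u = {}"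
  have "leaves C \<subseteq> leaves (C - {u})"
  proof
    fix v assume v: "v \<in> leaves C"
    with empty obtain w where "w \<in> C" "adj w v" "w \<noteq> u" by (auto simp: own_leaves_def)
    with v show "v \<in> leaves (C - {u})" by (auto simp: leaves_def)
  qed
  then have "score k C < score k (C - {u})"
    using assms C finite_C by (intro score_less_if_smaller card_mono card_Diff1_less) auto
  moreover have "C - {u} = toggle u C" using assms by (simp add: toggle_def)
  ultimately show False using opt assms C by (auto simp: locally_optimal_def leD)
qed

lemma sum_card_own_leaves: "(\<Sum>u\<in>C. card (own_leaves C u)) \<le> card (leaves C)"
proof -
  have "(\<Sum>u\<in>C. card (own_leaves C u)) = card (\<Union>u\<in>C. own_leaves C u)"
    using finite_C by (intro card_UN_disjoint[symmetric])
      (auto simp: own_leaves_def leaves_def finite_V)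
  also have "\<dots> \<le> card (leaves C)"
    by (intro card_mono) (auto simp: own_leaves_def)
  finally show ?thesis .
qed

lemma card_own_leaves_pos: "u \<in> C \<Longrightarrow> 1 \<le> card (own_leaves C u)"
  using own_leaves_nonempty[of u] by (simp add: own_leaves_def card_gt_0_iff Suc_le_eq)

text \<open>Every member has an own leaf, and own leaves of different members are disjoint.\<close>

lemma card_le_card_leaves: "card C \<le> card (leaves C)"
proof -
  have "card C = (\<Sum>u\<in>C. 1)" by simp
  also have "\<dots> \<le> (\<Sum>u\<in>C. card (own_leaves C u))"
    by (intro sum_mono card_own_leaves_pos)
  finally show ?thesis using sum_card_own_leaves by simp
qed

text \<open>Otherwise exchange \<open>u\<close> for its only own leaf \<open>y\<close>: the size
  stays, \<open>y\<close> is the only leaf lost, and both \<open>u\<close>, a neighbour of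
  \<open>y\<close>, and \<open>w\<close> become leaves.\<close>

lemma single_own_leaves_no_undominated:
  assumes u: "u \<in> C" "own_leaves C u = {y}" and w: "w \<in> undominated C" "adj y w"
  shows False
proof -
  have y: "y \<in> leaves C" "y \<notin> C" "y \<in> V" and w': "w \<notin> C" "w \<in> V" "w \<notin> leaves C"
    using u w by (auto simp: own_leaves_def leaves_def undominated_def)
  have "adj u y"
  proof -
    obtain x where "x \<in> C" "adj x y" using y by (auto simp: leaves_def)
    moreover have "y \<in> own_leaves C u" using u by simp
    ultimately show ?thesis by (auto simp: own_leaves_def)
  qed
  define C' where "C' = insert y (C - {u})"
  have "(leaves C - {y}) \<union> {u, w} \<subseteq> leaves C'"
  proof
    fix v assume "v \<in> (leaves C - {y}) \<union> {u, w}"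
    then consider "v \<in> leaves C" "v \<noteq> y" | "v = u" | "v = w" by auto
    then show "v \<in> leaves C'"
    proof cases
      case 1
      then have "v \<notin> own_leaves C u" using u by auto
      then obtain x where "x \<in> C" "adj x v" "x \<noteq> u" using 1 by (auto simp: own_leaves_def)
      then show ?thesis using 1 by (auto simp: leaves_def C'_def)
    next
      case 2
      then show ?thesis using u y C adj_sym[OF \<open>adj u y\<close>] by (auto simp: leaves_def C'_def)
    next
      case 3
      then show ?thesis using w w' y by (auto simp: leaves_def C'_def)
    qed
  qed
  then have "card ((leaves C - {y}) \<union> {u, w}) \<le> card (leaves C')"
    by (intro card_mono) auto
  moreover have "card ((leaves C - {y}) \<union> {u, w}) = card (leaves C - {y}) + 2"
  proof -
    have "u \<noteq> w" using u w' by auto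
    moreover have "(leaves C - {y}) \<inter> {u, w} = {}" using u w' by (auto simp: leaves_def)
    ultimately show ?thesis by (subst card_Un_disjoint) auto
  qed
  moreover have "card (leaves C - {y}) + 1 = card (leaves C)"
    using y by (metis Suc_eq_plus1 card_Suc_Diff1 finite_leaves)
  ultimately have "card (leaves C) < card (leaves C')" by simp
  moreover have "card C' = card C"
    using u y finite_C card_Suc_Diff1[OF finite_C u(1)] by (simp add: C'_def)
  ultimately have "score k C < score k C'"
    using C y by (intro score_less_if_leaves_less) (auto simp: C'_def)
  moreover have "C' = toggle y (toggle u C)" using u y by (auto simp: toggle_def C'_def)
  ultimately show False using opt u y C by (auto simp: locally_optimal_def leD)
qed

text \<open>The undominated forest vertices inject into the leaves next to undominated vertices, and
  such a leaf is never the only own leaf of a member. Counting own leaves then limits both these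
  leaves and the size of \<open>C\<close>.\<close>

lemma locally_optimal_bound:
  assumes small: "card C < k" and sf: "star_forest A T f"
  shows "2 * card T + card A \<le> 4 * card (leaves C)"
proof -
  define X where "X = {x \<in> leaves C. \<exists>w\<in>undominated C. adj x w}"
  define R where "R = (A \<union> T) \<inter> undominated C"
  have "\<exists>z\<in>X. adj z w" if w: "w \<in> R" for w
  proof -
    \<comment> \<open>A neighbour within the star: the center of \<open>w\<close>, or any leaf if
      \<open>w\<close> is a center itself.\<close>
    obtain z where z: "adj z w"
    proof (cases "w \<in> T")
      case True
      then show ?thesis using sf that by (auto simp: star_forest_def)
    next
      case False
      then obtain t where "t \<in> T" "w = f t" using w sf by (auto simp: R_def star_forest_def)
      then show ?thesis using sf that[of t] adj_sym by (auto simp: star_forest_def)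
    qed
    have zV: "z \<in> V" "z \<noteq> w" using z adj_V adj_irrefl by auto
    have zC: "z \<notin> C" using z w by (auto simp: R_def undominated_def leaves_def)
    \<comment> \<open>If \<open>z\<close> were undominated, inserting it would lose no leaf and gain
      \<open>w\<close>.\<close>
    have "z \<in> leaves C"
    proof (rule ccontr)
      assume nz: "z \<notin> leaves C"
      have "insert w (leaves C) \<subseteq> leaves (insert z C)"
        using w z zV nz by (auto simp: leaves_def R_def undominated_def)
      then have "card (insert w (leaves C)) \<le> card (leaves (insert z C))"
        by (intro card_mono) auto
      moreover have "w \<notin> leaves C" using w by (auto simp: R_def undominated_def)
      ultimately show False using no_gain_insert[OF small zV(1) zC] by simp
    qed
    then show ?thesis using z w by (auto simp: X_def R_def)
  qed
  then obtain h where h: "\<And>w. w \<in> R \<Longrightarrow> h w \<in> X \<and> adj (h w) w" by metis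
  \<comment> \<open>Two undominated neighbours of the same leaf would make its insertion profitable:
    one leaf is lost and two are gained.\<close>
  have "inj_on h R"
  proof (rule inj_onI, rule ccontr)
    fix w1 w2 assume w: "w1 \<in> R" "w2 \<in> R" "h w1 = h w2" "w1 \<noteq> w2"
    define z where "z = h w1"
    have z: "z \<in> leaves C" "adj z w1" "adj z w2" "z \<in> V" "z \<notin> C"
      using h[OF w(1)] h[OF w(2)] w(3) by (auto simp: z_def X_def leaves_def)
    have nw: "w1 \<notin> leaves C" "w2 \<notin> leaves C" using w by (auto simp: R_def undominated_def)
    have "(leaves C - {z}) \<union> {w1, w2} \<subseteq> leaves (insert z C)"
      using w z nw by (auto simp: leaves_def R_def undominated_def)
    then have "card ((leaves C - {z}) \<union> {w1, w2}) \<le> card (leaves (insert z C))"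
      by (intro card_mono) auto
    moreover have "card ((leaves C - {z}) \<union> {w1, w2}) = card (leaves C - {z}) + 2"
      using w nw by (subst card_Un_disjoint) auto
    moreover have "card (leaves C - {z}) + 1 = card (leaves C)"
      using z by (metis Suc_eq_plus1 card_Suc_Diff1 finite_leaves)
    ultimately show False using no_gain_insert[OF small z(4,5)] by simp
  qed
  moreover have "h ` R \<subseteq> X" using h by auto
  moreover have "finite X" by (simp add: X_def)
  ultimately have RX: "card R \<le> card X" using card_inj_on_le by blast
  have "A \<union> T \<subseteq> (C \<union> leaves C) \<union> R"
    using star_forestD[OF sf] by (auto simp: R_def undominated_def)
  then have "card (A \<union> T) \<le> card ((C \<union> leaves C) \<union> R)"
    using finite_C by (intro card_mono) (auto simp: R_def)
  also have "\<dots> \<le> card (C \<union> leaves C) + card R" by (rule card_Un_le)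
  finally have all: "card A + card T \<le> card C + card (leaves C) + card X"
    using RX star_forestD[OF sf] card_cover[OF C(1)] by simp
  \<comment> \<open>Otherwise \<open>star_gain\<close> with \<open>m = 1\<close> provides a
    profitable insertion.\<close>
  have cov: "card T \<le> card C + card (leaves C)"
  proof (rule ccontr)
    assume "\<not> ?thesis"
    then obtain s where "s \<in> V - C" "card (leaves C) + 1 \<le> card (leaves (insert s C))"
      using star_gain[OF sf C(1), of 1] by auto
    then show False using no_gain_insert[OF small, of s] by simp
  qed
  define C1 where "C1 = {u\<in>C. card (own_leaves C u) = 1}"
  have finC1: "finite C1" "finite (C - C1)" using finite_C by (auto simp: C1_def)
  have "card (\<Union>u\<in>C1. own_leaves C u) = (\<Sum>u\<in>C1. card (own_leaves C u))"
    using finC1 by (intro card_UN_disjoint) (auto simp: own_leaves_def leaves_def C1_def finite_V)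
  also have "\<dots> = card C1" by (simp add: C1_def)
  finally have c1: "card (\<Union>u\<in>C1. own_leaves C u) = card C1" .
  have "X \<inter> (\<Union>u\<in>C1. own_leaves C u) = {}"
  proof (rule ccontr)
    assume "X \<inter> (\<Union>u\<in>C1. own_leaves C u) \<noteq> {}"
    then obtain x u where x: "x \<in> X" "x \<in> own_leaves C u" "u \<in> C" "card (own_leaves C u) = 1"
      by (auto simp: C1_def)
    then have "own_leaves C u = {x}" by (metis card_1_singletonE singletonD)
    then show False using single_own_leaves_no_undominated[of u x] x by (auto simp: X_def)
  qed
  then have "card X + card C1 = card (X \<union> (\<Union>u\<in>C1. own_leaves C u))"
    using c1 \<open>finite X\<close> finC1 by (subst card_Un_disjoint) (auto simp: own_leaves_def)
  also have "\<dots> \<le> card (leaves C)"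
    by (intro card_mono) (auto simp: X_def own_leaves_def)
  finally have X: "card X + card C1 \<le> card (leaves C)" .
  \<comment> \<open>Members outside \<open>C1\<close> have at least two own leaves.\<close>
  have "card C1 + 2 * card (C - C1) = (\<Sum>u\<in>C1. 1) + (\<Sum>u\<in>C - C1. 2)" by simp
  also have "\<dots> \<le> (\<Sum>u\<in>C1. card (own_leaves C u)) + (\<Sum>u\<in>C - C1. card (own_leaves C u))"
  proof (intro add_mono sum_mono)
    fix u assume "u \<in> C - C1"
    then show "2 \<le> card (own_leaves C u)" using card_own_leaves_pos[of u] by (auto simp: C1_def)
  qed (auto simp: C1_def)
  also have "\<dots> = (\<Sum>u\<in>C. card (own_leaves C u))"
    using finite_C by (subst add.commute, intro sum.subset_diff[symmetric]) (auto simp: C1_def)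
  also have "\<dots> \<le> card (leaves C)" by (rule sum_card_own_leaves)
  finally have P: "card C1 + 2 * card (C - C1) \<le> card (leaves C)" .
  have "card C = card C1 + card (C - C1)"
    using finC1 finite_C by (metis C1_def Collect_subset card_Diff_subset card_mono le_add_diff_inverse Collect_conj_eq inf_le1 Collect_mem_eq)
  \<comment> \<open>Adding \<open>all\<close> and \<open>cov\<close> bounds
    \<open>2 * card T + card A\<close> by \<open>2 * card C + 2 * card (leaves C) + card X\<close>;
    adding \<open>X\<close> and \<open>P\<close> bounds \<open>2 * card C + card X\<close> by
    \<open>2 * card (leaves C)\<close>.\<close>
  then show ?thesis using all cov X P by linarith
qed

end


section \<open>The search path and its greedy phase\<close>

text \<open>
  The last condition holds because the search tries pairs only after no single toggle improves.
\<close>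

inductive search_path :: "nat \<Rightarrow> 'a set \<Rightarrow> bool" for k where
  start: "search_path k {}"
| step: "search_path k C \<Longrightarrow> score k C < score k C' \<Longrightarrow>
    (\<And>v. v \<in> V \<Longrightarrow> score k (toggle v C) \<le> score k C') \<Longrightarrow>
    card (C' \<inter> V) \<le> card (C \<inter> V) + 1 \<or> (\<forall>v\<in>V. score k (toggle v C) \<le> score k C) \<Longrightarrow>
    search_path k C'"

text \<open>Sets that are too large have score 0, which no improvement can reach.\<close>

lemma search_path_card: "search_path k C \<Longrightarrow> card (C \<inter> V) \<le> k"
proof (induction rule: search_path.induct)
  case (step C C')
  from step(2) have "score k C' \<noteq> 0" by simp
  then show ?case by (auto simp: score_def split: if_splits)
qed simp

lemma score_toggle_gain:
  assumes sf: "star_forest A T f" and small: "card (C \<inter> V) < k"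
    and less: "card (C \<inter> V) + card (leaves C) + m * card A < card T + card A"
  obtains s where "s \<in> V" "s \<notin> C" "card (toggle s C \<inter> V) \<le> k"
    "card (leaves C) + m \<le> card (leaves (toggle s C))"
proof -
  obtain s where s: "s \<in> V - (C \<inter> V)"
    "card (leaves C) + m \<le> card (leaves (insert s (C \<inter> V)))"
    using star_gain[OF sf, of "C \<inter> V" m] less by (auto simp: leaves_Int)
  have *: "toggle s C \<inter> V = insert s (C \<inter> V)" using s by (auto simp: toggle_def)
  then have "card (toggle s C \<inter> V) \<le> k"
    using small card_insert_le_m1[of k "C \<inter> V" s] by simp
  moreover have "leaves (toggle s C) = leaves (insert s (C \<inter> V))"
    using * leaves_Int[of "toggle s C"] by simp
  ultimately show ?thesis using that[of s] s by auto
qed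

lemma leaves_mono_score:
  assumes "card (C \<inter> V) \<le> k" "card (C' \<inter> V) \<le> k" "score k C \<le> score k C'"
  shows "card (leaves C) \<le> card (leaves C')"
  using score_le_imp_leaves_le[of "C \<inter> V" "C' \<inter> V" k] assms by (simp add: leaves_Int score_Int)

lemma score_less_leaves:
  assumes "card (C \<inter> V) \<le> k" "card (C' \<inter> V) \<le> k" "card (leaves C) < card (leaves C')"
  shows "score k C < score k C'"
  using score_less_if_leaves_less[of "C \<inter> V" "C' \<inter> V" k] assms by (simp add: leaves_Int score_Int)

text \<open>\<open>B j\<close> is a lower bound for the number of leaves after \<open>j\<close>
  insertions, and \<open>\<tau>\<close> is the target. Steps may also delete vertices, so
  \<open>j\<close> only bounds the size from above; this suffices because a smaller set makes the
  premise of \<open>star_gain\<close> easier to meet. \<open>stuck\<close> covers the case where no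
  gain is promised: then there are enough leaves already.\<close>

lemma greedy_invariant:
  fixes B :: "nat \<Rightarrow> real" and \<tau> :: real
  assumes path: "search_path k C" and sf: "star_forest A T f" and k: "card A \<le> k"
    and B0: "B 0 \<le> 0"
    and Bstep: "\<And>j d d'. \<lbrakk>j < card A; B j \<le> real d; d \<le> d'; j + d < card T;
        \<And>m. j + d + m * card A < card T + card A \<Longrightarrow> d + m \<le> d'\<rbrakk> \<Longrightarrow> B (Suc j) \<le> real d'"
    and stuck: "\<And>j d. \<lbrakk>j < card A; B j \<le> real d; card T \<le> j + d\<rbrakk> \<Longrightarrow> \<tau> \<le> real d"
    and Bend: "\<tau> \<le> B (card A)"
  shows "\<tau> \<le> real (card (leaves C)) \<or>
    (\<exists>j < card A. card (C \<inter> V) \<le> j \<and> B j \<le> real (card (leaves C)))"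
  using path
proof (induction rule: search_path.induct)
  case start
  show ?case
  proof (cases "card A = 0")
    case True
    then have "\<tau> \<le> 0" using B0 Bend by simp
    then show ?thesis by (meson of_nat_0_le_iff order_trans)
  next
    case False
    then show ?thesis using B0 by (intro disjI2 exI[of _ 0]) (auto intro: order_trans)
  qed
next
  case (step C C')
  have cC: "card (C \<inter> V) \<le> k" using search_path_card step by blast
  have cC': "card (C' \<inter> V) \<le> k"
    using search_path_card[OF search_path.step[OF step(1-4)]] .
  have mono: "card (leaves C) \<le> card (leaves C')"
    using leaves_mono_score[OF cC cC'] step(2) by simp
  show ?case
  proof (cases "\<tau> \<le> real (card (leaves C))")
    case True
    then show ?thesis using mono by simp
  next
    case False
    then obtain j where j: "j < card A" "card (C \<inter> V) \<le> j" "B j \<le> real (card (leaves C))"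
      using step.IH by auto
    have unstuck: "j + card (leaves C) < card T"
      using stuck[OF j(1,3)] False by (meson not_le)
    have small: "card (C \<inter> V) < k" using j k by simp
    have gain: "card (leaves C) + m \<le> card (leaves C')"
      if "j + card (leaves C) + m * card A < card T + card A" for m
    proof -
      have "card (C \<inter> V) + card (leaves C) + m * card A < card T + card A" using that j by simp
      then obtain s where s: "s \<in> V" "card (toggle s C \<inter> V) \<le> k"
        "card (leaves C) + m \<le> card (leaves (toggle s C))"
        using score_toggle_gain[OF sf small] by metis
      have "card (leaves (toggle s C)) \<le> card (leaves C')"
        using leaves_mono_score[OF s(2) cC'] step(3)[OF s(1)] by simp
      then show ?thesis using s by simp
    qed
    have B': "B (Suc j) \<le> real (card (leaves C'))"
      using Bstep[OF j(1,3) mono unstuck gain] by simp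
    \<comment> \<open>Some single toggle improves. This excludes the second alternative of
      \<open>step\<close>, so the size grows by at most one.\<close>
    have "card (C \<inter> V) + card (leaves C) + 1 * card A < card T + card A" using unstuck j by simp
    then obtain s where s: "s \<in> V" "card (toggle s C \<inter> V) \<le> k"
      "card (leaves C) + 1 \<le> card (leaves (toggle s C))"
      using score_toggle_gain[OF sf small] by metis
    then have "score k C < score k (toggle s C)" using score_less_leaves[OF cC s(2)] by simp
    then have "card (C' \<inter> V) \<le> card (C \<inter> V) + 1" using step(4) s(1) by (meson not_le)
    then have "card (C' \<inter> V) \<le> Suc j" using j by simp
    moreover have "Suc j < card A \<or> Suc j = card A" using j by auto
    ultimately show ?thesis using B' Bend by fastforce
  qed
qed

text \<open>At a local optimum the second alternative of the invariant also yields the target: if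
  \<open>stuck\<close> does not apply, an insertion would still improve.\<close>

lemma greedy_bound:
  fixes B :: "nat \<Rightarrow> real" and \<tau> :: real
  assumes path: "search_path k C" and opt: "locally_optimal k C"
    and sf: "star_forest A T f" and k: "card A \<le> k"
    and B0: "B 0 \<le> 0"
    and Bstep: "\<And>j d d'. \<lbrakk>j < card A; B j \<le> real d; d \<le> d'; j + d < card T;
        \<And>m. j + d + m * card A < card T + card A \<Longrightarrow> d + m \<le> d'\<rbrakk> \<Longrightarrow> B (Suc j) \<le> real d'"
    and stuck: "\<And>j d. \<lbrakk>j < card A; B j \<le> real d; card T \<le> j + d\<rbrakk> \<Longrightarrow> \<tau> \<le> real d"
    and Bend: "\<tau> \<le> B (card A)"
  shows "\<tau> \<le> real (card (leaves C))"
proof (rule ccontr)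
  assume low: "\<not> ?thesis"
  have "\<tau> \<le> real (card (leaves C)) \<or>
    (\<exists>j < card A. card (C \<inter> V) \<le> j \<and> B j \<le> real (card (leaves C)))"
    by (rule greedy_invariant[OF path sf k B0 Bstep stuck Bend])
  then obtain j where j: "j < card A" "card (C \<inter> V) \<le> j" "B j \<le> real (card (leaves C))"
    using low by auto
  have "j + card (leaves C) < card T" using stuck[OF j(1,3)] low by (meson not_le)
  then have "card (C \<inter> V) + card (leaves C) + 1 * card A < card T + card A" using j by simp
  moreover have small: "card (C \<inter> V) < k" using j k by simp
  ultimately obtain s where s: "s \<in> V" "card (toggle s C \<inter> V) \<le> k"
      "card (leaves C) + 1 \<le> card (leaves (toggle s C))"
    using score_toggle_gain[OF sf small] by metis
  then have "score k C < score k (toggle s C)" using score_less_leaves[OF _ s(2)] small by simp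
  then show False using opt s(1) by (meson locally_optimal_def not_le)
qed

text \<open>Gains are integral. With \<open>l = card T\<close> and \<open>c = card A\<close>, a step
  gains at least 3, 2 or 1 leaves while \<open>j + d\<close> is below \<open>l - 2 * c\<close>,
  \<open>l - c\<close> or \<open>l\<close>; the piecewise linear \<open>B\<close> follows this
  pace.\<close>

lemma greedy_bound_few_leaves:
  assumes path: "search_path k C" and opt: "locally_optimal k C"
    and sf: "star_forest A T f" and k: "card A \<le> k"
    and ratio: "7 * card A \<le> 4 * card T" "card T \<le> 5 * card A"
  shows "531 / 1000 * real (card T) \<le> real (card (leaves C))"
proof -
  define c where "c = real (card A)"
  define l where "l = real (card T)"
  have r: "7 * c \<le> 4 * l" "l \<le> 5 * c"
    using ratio unfolding c_def l_def by (simp_all flip: of_nat_mult of_nat_le_iff)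
  \<comment> \<open>\<open>B j + j\<close> grows by 4 per step up to \<open>l - 2 c\<close>, then by 3 up to \<open>l - c\<close>, then by 2.\<close>
  define B where "B j = min (3 * j) (min (2 * j + (l - 2 * c) / 4) (j + l / 2 - 2 * c / 3))" for j
  have "531 / 1000 * l \<le> real (card (leaves C))"
  proof (rule greedy_bound[OF path opt sf k, where B = "\<lambda>j. B (real j)"])
    show "B (real 0) \<le> 0" by (simp add: B_def)
    \<comment> \<open>At \<open>j = c\<close> the branches are \<open>3 * c\<close>,
      \<open>3 / 2 * c + l / 4\<close> and \<open>c / 3 + l / 2\<close>; by
      \<open>l \<le> 5 * c\<close> each is at least \<open>531 / 1000 * l\<close>.\<close>
    show "531 / 1000 * l \<le> B (real (card A))" using r unfolding B_def c_def[symmetric] by (simp add: field_simps)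
  next
    \<comment> \<open>Eliminating \<open>j\<close> from \<open>l \<le> j + d\<close> branch by
      branch, the last branch is the tightest: it gives
      \<open>2 * d \<ge> 3 / 2 * l - 2 / 3 * c\<close>, hence \<open>d \<ge> 47 / 84 * l\<close> by
      \<open>7 * c \<le> 4 * l\<close>.\<close>
    fix j d assume "j < card A" "B (real j) \<le> real d" "card T \<le> j + d"
    then have "l \<le> real j + real d" by (simp add: l_def flip: of_nat_add)
    with \<open>B (real j) \<le> real d\<close> show "531 / 1000 * l \<le> real d"
      using r unfolding B_def min_def by (auto split: if_splits simp: field_simps)
  next
    fix j d d' assume *: "j < card A" "B (real j) \<le> real d" "d \<le> d'" "j + d < card T"
      and gain: "\<And>m. j + d + m * card A < card T + card A \<Longrightarrow> d + m \<le> d'"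
    have g: "real d + real m \<le> real d'" if "real j + real d + real m * c < l + c" for m
      using gain[of m] that by (simp add: c_def l_def flip: of_nat_add of_nat_mult)
    have "real d + 1 \<le> real d'" using g[of 1] *(4) by (simp add: l_def flip: of_nat_add)
    moreover have "real d + 2 \<le> real d'" if "real j + real d + c < l" using g[of 2] that by simp
    moreover have "real d + 3 \<le> real d'" if "real j + real d + 2 * c < l" using g[of 3] that by simp
    ultimately consider "real j + real d + 2 * c < l" "real d + 3 \<le> real d'"
      | "l \<le> real j + real d + 2 * c" "real j + real d + c < l" "real d + 2 \<le> real d'"
      | "l \<le> real j + real d + c" "real d + 1 \<le> real d'" by linarith
    \<comment> \<open>If the gain is smaller than the slope of the branch that is below
      \<open>d\<close>, the lower bound on \<open>j + d\<close> in this case shows that a flatter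
      branch is below \<open>d\<close> too.\<close>
    then show "B (real (Suc j)) \<le> real d'"
      using *(2) r unfolding B_def min_le_iff_disj by cases (simp_all, argo+)
  qed
  then show ?thesis by (simp add: l_def)
qed

text \<open>The maximum coverage estimate: \<open>B j + j\<close> tracks the number of covered
  vertices, and each step covers at least the fraction \<open>1 / c\<close> of what is missing to
  \<open>l + c\<close>.\<close>

lemma greedy_bound_many_leaves:
  assumes path: "search_path k C" and opt: "locally_optimal k C"
    and sf: "star_forest A T f" and k: "card A \<le> k"
    and ratio: "5 * card A \<le> card T"
  shows "531 / 1000 * real (card T) \<le> real (card (leaves C))"
proof (cases "card A = 0")
  case True
  then have "A = {}" using star_forestD[OF sf] by simp
  then have "T = {}" using sf by (auto simp: star_forest_def)
  then show ?thesis by simp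
next
  case False
  define c where "c = real (card A)"
  define l where "l = real (card T)"
  have r: "5 * c \<le> l" "c \<ge> 1"
    using ratio False unfolding c_def l_def by linarith+
  define B where "B j = (l + c) * (1 - (1 - 1 / c) ^ j) - real j" for j
  have "531 / 1000 * l \<le> real (card (leaves C))"
  proof (rule greedy_bound[OF path opt sf k, where B = B])
    show "B 0 \<le> 0" by (simp add: B_def)
    have "(1 - 1 / c) ^ card A \<le> exp (- 1 / c) ^ card A"
      using exp_ge_add_one_self[of "- 1 / c"] r by (intro power_mono) (auto simp: field_simps)
    also have "\<dots> = exp (- 1)"
      using r by (simp add: c_def flip: exp_of_nat_mult)
    \<comment> \<open>With 0.39 in place of \<open>exp (- 1)\<close> the claim at
      \<open>j = c\<close> becomes \<open>0.079 * l \<ge> 0.39 * c\<close>, which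
      \<open>5 * c \<le> l\<close> implies.\<close>
    also have "\<dots> \<le> 39 / 100"
    proof -
      have "1 \<le> 39 / 100 * exp (1 :: real)" using e_approx_32 by (simp add: abs_if split: if_splits)
      then show ?thesis by (simp add: exp_minus field_simps)
    qed
    finally have "(l + c) * (1 - 39 / 100) \<le> (l + c) * (1 - (1 - 1 / c) ^ card A)"
      using r by (intro mult_left_mono) auto
    then show "531 / 1000 * l \<le> B (card A)" using r unfolding B_def c_def[symmetric] by simp
  next
    fix j d assume "j < card A" "card T \<le> j + d"
    then have "l \<le> c + real d" by (simp add: l_def c_def flip: of_nat_add)
    then show "531 / 1000 * l \<le> real d" using r by simp
  next
    fix j d d' assume *: "j < card A" "B j \<le> real d" "d \<le> d'"
      and gain: "\<And>m. j + d + m * card A < card T + card A \<Longrightarrow> d + m \<le> d'"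
    obtain e where e: "d' = d + e" using *(3) le_Suc_ex by blast
    \<comment> \<open>The gain is exactly \<open>e\<close>, so the premise of \<open>gain\<close>
      must fail for \<open>m = e + 1\<close>. Equivalently, the cover grows by at least
      \<open>1 / c\<close> of the deficit.\<close>
    have "card T + card A \<le> j + d + (e + 1) * card A"
      using gain[of "e + 1"] e by (rule_tac ccontr) simp
    then have "real (card T + card A) \<le> real (j + d + (e + 1) * card A)"
      by (simp only: of_nat_le_iff)
    then have g: "l + c \<le> j + d + (real d' - d + 1) * c"
      using e by (simp add: l_def c_def algebra_simps)
    \<comment> \<open>This says that the distance of \<open>B j + j\<close> to \<open>l + c\<close>
      shrinks by the factor \<open>1 - 1 / c\<close>.\<close>
    have "B (Suc j) = B j * (1 - 1 / c) + (l - j) / c"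
      using r by (simp add: B_def field_simps)
    also have "\<dots> \<le> d * (1 - 1 / c) + (l - j) / c"
      using *(2) r by (intro add_right_mono mult_right_mono) (auto simp: field_simps)
    also have "\<dots> = (d * (c - 1) + (l - j)) / c" using r by (simp add: field_simps)
    also have "\<dots> \<le> d'" using g r by (simp add: pos_divide_le_eq algebra_simps)
    finally show "B (Suc j) \<le> real d'" .
  qed
  then show ?thesis by (simp add: l_def)
qed

theorem local_search_approximation:
  assumes path: "search_path k C" and opt: "locally_optimal k C" and S: "card S \<le> k" "finite S"
  shows "531 / 1000 * real (card (leaves S)) \<le> real (card (leaves C))"
proof -
  define T where "T = leaves S"
  obtain f where f: "\<And>t. t \<in> T \<Longrightarrow> f t \<in> S \<and> adj (f t) t"
  proof -
    have "\<exists>u. u \<in> S \<and> adj u t" if "t \<in> T" for t using that by (auto simp: T_def leaves_def)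
    then show ?thesis using that by metis
  qed
  \<comment> \<open>Each leaf of \<open>S\<close> picks one neighbour in \<open>S\<close>. Members
    that are never picked are dropped, so at most \<open>k\<close> centers remain.\<close>
  define A where "A = f ` T"
  have sf: "star_forest A T f"
    using f unfolding star_forest_def A_def by (auto simp: T_def leaves_def)
  have "card A \<le> card S" using f S by (intro card_mono) (auto simp: A_def)
  then have k: "card A \<le> k" using S by simp
  have cC: "card (C \<inter> V) \<le> k" using search_path_card[OF path] .
  \<comment> \<open>The path may carry a non-vertex, whereas the bounds for local optima speak of
    sets of vertices.\<close>
  have opt': "locally_optimal k (C \<inter> V)"
    unfolding locally_optimal_def
  proof (intro conjI ballI)
    fix x y assume "x \<in> V" "y \<in> V"
    then show "score k (toggle x (C \<inter> V)) \<le> score k (C \<inter> V)"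
      "score k (toggle x (toggle y (C \<inter> V))) \<le> score k (C \<inter> V)"
      using opt by (simp_all add: locally_optimal_def score_Int flip: toggle_Int)
  qed
  have "531 / 1000 * real (card T) \<le> real (card (leaves C))"
  proof -
    \<comment> \<open>Below the ratio 7/4, a set with fewer than \<open>k\<close> vertices has at
      least \<open>9 / 14 * card T\<close> leaves by \<open>locally_optimal_bound\<close>, and a
      full one has at least \<open>card A > 4 / 7 * card T\<close>.\<close>
    consider "4 * card T < 7 * card A" "card (C \<inter> V) < k"
      | "4 * card T < 7 * card A" "card (C \<inter> V) = k"
      | "7 * card A \<le> 4 * card T" "card T \<le> 5 * card A" | "5 * card A \<le> card T"
      using cC by linarith
    then show ?thesis
    proof cases
      case 1
      then show ?thesis
        using locally_optimal_bound[OF _ cC opt' 1(2) sf] by (simp add: leaves_Int)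
    next
      case 2
      then have "card A \<le> card (leaves C)"
        using card_le_card_leaves[OF _ cC opt'] k by (simp add: leaves_Int)
      then show ?thesis using 2 by linarith
    next
      case 3
      then show ?thesis by (rule greedy_bound_few_leaves[OF path opt sf k])
    next
      case 4
      then show ?thesis by (rule greedy_bound_many_leaves[OF path opt sf k])
    qed
  qed
  then show ?thesis by (simp add: T_def)
qed

end

section \<open>Reasoning about RAM programs\<close>

text \<open>Total correctness with an upper bound on the time, so that crude bounds can be composed
  by addition.\<close>

definition runs ::
    "ram \<Rightarrow> (nat \<Rightarrow> nat) \<Rightarrow> (nat \<Rightarrow> nat) \<Rightarrow> nat \<Rightarrow> ((nat \<Rightarrow> nat) \<Rightarrow> (nat \<Rightarrow> nat) \<Rightarrow> bool) \<Rightarrow> bool"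
  where "runs p r m T Q \<longleftrightarrow> (\<exists>t r' m'. exec p (r, m) t (r', m') \<and> t \<le> T \<and> Q r' m')"

lemma runs_mono:
  "runs p r m T Q \<Longrightarrow> T \<le> T' \<Longrightarrow> (\<And>r' m'. Q r' m' \<Longrightarrow> Q' r' m') \<Longrightarrow> runs p r m T' Q'"
  unfolding runs_def by (meson order_trans)

lemma runs_Seq:
  assumes "runs p r m T P" "\<And>r' m'. P r' m' \<Longrightarrow> runs q r' m' U Q"
  shows "runs (Seq p q) r m (T + U) Q"
proof -
  from assms(1) obtain t r1 m1 where 1: "exec p (r, m) t (r1, m1)" "t \<le> T" "P r1 m1"
    by (auto simp: runs_def)
  from assms(2)[OF 1(3)] obtain u r2 m2 where 2: "exec q (r1, m1) u (r2, m2)" "u \<le> U" "Q r2 m2"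
    by (auto simp: runs_def)
  show ?thesis unfolding runs_def
    using exec.Seq[OF 1(1) 2(1)] add_mono[OF 1(2) 2(2)] 2(3) by blast
qed

lemma runs_Seq3:
  assumes "runs p r m T P" "\<And>r' m'. P r' m' \<Longrightarrow> runs q r' m' U P'"
    "\<And>r' m'. P' r' m' \<Longrightarrow> runs q' r' m' W Q"
  shows "runs (Seq p (Seq q q')) r m (T + (U + W)) Q"
  by (rule runs_Seq[OF assms(1)], rule runs_Seq[OF assms(2)], assumption, rule assms(3))

text \<open>\<open>\<mu>\<close> bounds the number of rounds. Each costs its body and one test, and
  the failing test costs 1 more.\<close>

lemma runs_While:
  fixes \<mu> :: "(nat \<Rightarrow> nat) \<Rightarrow> (nat \<Rightarrow> nat) \<Rightarrow> nat"
  assumes "I r m"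
    and "\<And>r m. I r m \<Longrightarrow> r a \<noteq> 0 \<Longrightarrow> runs p r m T (\<lambda>r' m'. I r' m' \<and> \<mu> r' m' < \<mu> r m)"
  shows "runs (WhileNZ a p) r m (\<mu> r m * (T + 1) + 1) (\<lambda>r' m'. I r' m' \<and> r' a = 0)"
  using assms(1)
proof (induction "\<mu> r m" arbitrary: r m rule: less_induct)
  case less
  show ?case
  proof (cases "r a = 0")
    case True
    then have "exec (WhileNZ a p) (r, m) 1 (r, m)" by (intro exec.WhileFalse) simp
    then show ?thesis using True less.prems unfolding runs_def
      by (metis le_add2)
  next
    case False
    obtain t r1 m1 where 1: "exec p (r, m) t (r1, m1)" "t \<le> T" "I r1 m1" "\<mu> r1 m1 < \<mu> r m"
      using assms(2)[OF less.prems False] by (auto simp: runs_def)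
    obtain u r2 m2 where 2: "exec (WhileNZ a p) (r1, m1) u (r2, m2)"
      "u \<le> \<mu> r1 m1 * (T + 1) + 1" "I r2 m2" "r2 a = 0"
      using less.hyps[OF 1(4,3)] by (auto simp: runs_def)
    have "exec (WhileNZ a p) (r, m) (t + u + 1) (r2, m2)"
      using False 1(1) 2(1) by (intro exec.WhileTrue) auto
    moreover have "t + u + 1 \<le> \<mu> r m * (T + 1) + 1"
    proof -
      have "(\<mu> r1 m1 + 1) * (T + 1) \<le> \<mu> r m * (T + 1)" using 1(4) by (intro mult_le_mono1) simp
      then show ?thesis using 1(2) 2(2) by simp
    qed
    ultimately show ?thesis using 2 unfolding runs_def by blast
  qed
qed

text \<open>The invariant is indexed by the number \<open>j\<close> of completed rounds, and the
  second premise ties the counter register \<open>a\<close> to it.\<close>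

lemma runs_countdown:
  assumes "I 0 r m" "\<And>j r m. I j r m \<Longrightarrow> r a = N - j"
    and "\<And>j r m. j < N \<Longrightarrow> I j r m \<Longrightarrow> runs p r m T (I (Suc j))"
  shows "runs (WhileNZ a p) r m (N * (T + 1) + 1) (I N)"
proof -
  have "runs (WhileNZ a p) r m (r a * (T + 1) + 1)
      (\<lambda>r' m'. (\<exists>j\<le>N. I j r' m') \<and> r' a = 0)"
  proof (rule runs_While[where \<mu> = "\<lambda>r m. r a"])
    show "\<exists>j\<le>N. I j r m" using assms(1) by auto
  next
    fix r m assume "\<exists>j\<le>N. I j r m" "r a \<noteq> 0"
    then obtain j where j: "j < N" "I j r m" using assms(2) by fastforce
    show "runs p r m T (\<lambda>r' m'. (\<exists>j\<le>N. I j r' m') \<and> r' a < r a)"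
    proof (rule runs_mono[OF assms(3)[OF j]])
      fix r' m' assume "I (Suc j) r' m'"
      then show "(\<exists>j\<le>N. I j r' m') \<and> r' a < r a"
        using j assms(2)[OF j(2)] assms(2)[of "Suc j" r' m'] by (auto intro!: exI[of _ "Suc j"])
    qed simp
  qed
  then show ?thesis
  proof (rule runs_mono)
    show "r a * (T + 1) + 1 \<le> N * (T + 1) + 1" using assms(2)[OF assms(1)] by simp
  next
    fix r' m' assume "(\<exists>j\<le>N. I j r' m') \<and> r' a = 0"
    then obtain j where j: "j \<le> N" "I j r' m'" "r' a = 0" by auto
    then have "j = N" using assms(2)[OF j(2)] by simp
    then show "I N r' m'" using j by simp
  qed
qed

section \<open>Symbolic execution of loop-free code\<close>

fun loop_free :: "ram \<Rightarrow> bool" where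
  "loop_free (Seq p q) \<longleftrightarrow> loop_free p \<and> loop_free q"
| "loop_free (IfNZ a p q) \<longleftrightarrow> loop_free p \<and> loop_free q"
| "loop_free (WhileNZ a p) \<longleftrightarrow> False"
| "loop_free _ \<longleftrightarrow> True"

text \<open>Both branches are added, a crude bound in place of the maximum.\<close>

fun cost :: "ram \<Rightarrow> nat" where
  "cost (Seq p q) = cost p + cost q"
| "cost (IfNZ a p q) = cost p + cost q + 1"
| "cost _ = 1"

text \<open>Loop-free code acts as a function that the simplifier can evaluate. The value on
  \<open>WhileNZ\<close> is a dummy, excluded by \<open>loop_free\<close>.\<close>

fun eff :: "ram \<Rightarrow> ram_state \<Rightarrow> ram_state" where
  "eff (Const a k) (r, m) = (r(a := k), m)"
| "eff (Add a b c) (r, m) = (r(a := r b + r c), m)"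
| "eff (Sub a b c) (r, m) = (r(a := r b - r c), m)"
| "eff (Load a b) (r, m) = (r(a := m (r b)), m)"
| "eff (Store a b) (r, m) = (r, m(r a := r b))"
| "eff (Seq p q) s = eff q (eff p s)"
| "eff (IfNZ a p q) (r, m) = (if r a \<noteq> 0 then eff p (r, m) else eff q (r, m))"
| "eff _ s = s"

lemma exec_eff: "loop_free p \<Longrightarrow> \<exists>t\<le>cost p. exec p s t (eff p s)"
proof (induction p arbitrary: s)
  case (Seq p q)
  then obtain t u where "t \<le> cost p" "exec p s t (eff p s)" "u \<le> cost q"
    "exec q (eff p s) u (eff q (eff p s))" by (metis loop_free.simps(1))
  then show ?case
    using exec.Seq[of p s t "eff p s" q u "eff q (eff p s)"] by (auto intro!: exI[of _ "t + u"])
next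
  case (IfNZ a p q)
  obtain r m where s: "s = (r, m)" by (cases s)
  obtain t u where *: "t \<le> cost p" "exec p s t (eff p s)" "u \<le> cost q" "exec q s u (eff q s)"
    using IfNZ by (metis loop_free.simps(2))
  show ?case
  proof (cases "r a = 0")
    case True
    then show ?thesis using exec.IfFalse[of s a q u "eff q s" p] * s
      by (auto intro!: exI[of _ "u + 1"])
  next
    case False
    then show ?thesis using exec.IfTrue[of s a p t "eff p s" q] * s
      by (auto intro!: exI[of _ "t + 1"])
  qed
next
  case Skip
  show ?case by (intro exI[of _ 1]) (simp add: exec.Skip[simplified])
next
  case (Const a k)
  show ?case by (cases s, intro exI[of _ 1]) (simp add: exec.Const[simplified])
next
  case (Add a b c)
  show ?case by (cases s, intro exI[of _ 1]) (simp add: exec.Add[simplified])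
next
  case (Sub a b c)
  show ?case by (cases s, intro exI[of _ 1]) (simp add: exec.Sub[simplified])
next
  case (Load a b)
  show ?case by (cases s, intro exI[of _ 1]) (simp add: exec.Load[simplified])
next
  case (Store a b)
  show ?case by (cases s, intro exI[of _ 1]) (simp add: exec.Store[simplified])
qed simp

lemma runs_eff:
  assumes "loop_free p" "cost p \<le> T" "case eff p (r, m) of (r', m') \<Rightarrow> Q r' m'"
  shows "runs p r m T Q"
proof -
  obtain t where t: "t \<le> cost p" "exec p (r, m) t (eff p (r, m))" using exec_eff[OF assms(1)] by auto
  moreover obtain r' m' where "eff p (r, m) = (r', m')" by force
  ultimately show ?thesis using assms(2,3) unfolding runs_def
    by (intro exI[of _ t] exI[of _ r'] exI[of _ m']) auto
qed

section \<open>The program\<close>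

abbreviation (input) seq_right (infixr ";;" 61) where "p ;; q \<equiv> Seq p q"
text \<open>
  Register \<open>R_zero\<close> is never written, so it keeps its initial value 0.
\<close>

abbreviation (input) "R_zero \<equiv> 0 :: nat"
abbreviation (input) "R_one \<equiv> 2 :: nat"
abbreviation (input) "R_n \<equiv> 3 :: nat"
abbreviation (input) "R_k \<equiv> 4 :: nat"
abbreviation (input) "R_rows \<equiv> 5 :: nat"
abbreviation (input) "R_bits \<equiv> 6 :: nat"
abbreviation (input) "R_cls \<equiv> 7 :: nat"
abbreviation (input) "R_leaf \<equiv> 8 :: nat"
abbreviation (input) "R_cur \<equiv> 9 :: nat"
abbreviation (input) "R_x \<equiv> 10 :: nat"
abbreviation (input) "R_best \<equiv> 11 :: nat"
abbreviation (input) "R_by \<equiv> 12 :: nat"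
abbreviation (input) "R_y \<equiv> 13 :: nat"
abbreviation (input) "R_acc \<equiv> 14 :: nat"
abbreviation (input) "R_cnt \<equiv> 15 :: nat"
abbreviation (input) "R_v \<equiv> 16 :: nat"
abbreviation (input) "R_pa \<equiv> 17 :: nat"
abbreviation (input) "R_pb \<equiv> 18 :: nat"
abbreviation (input) "R_pc \<equiv> 19 :: nat"
abbreviation (input) "R_u \<equiv> 20 :: nat"
abbreviation (input) "R_qb \<equiv> 21 :: nat"
abbreviation (input) "R_flag \<equiv> 22 :: nat"
abbreviation (input) "R_s \<equiv> 23 :: nat"
abbreviation (input) "R_t \<equiv> 24 :: nat"
abbreviation (input) "R_w \<equiv> 25 :: nat"

abbreviation "Copy a b \<equiv> Add a b R_zero"
abbreviation "Inc a \<equiv> Add a a R_one"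
abbreviation "Dec a \<equiv> Sub a a R_one"

text \<open>Tests for a neighbour in the current set by walking along a matrix row and the
  membership bits together. \<open>R_pa\<close> ends at the next row, ready for the next
  vertex.\<close>

definition row_scan :: ram where
  "row_scan = WhileNZ R_u
     (Load R_s R_pa ;; Load R_t R_qb ;; IfNZ R_s (IfNZ R_t (Const R_flag 1) Skip) Skip ;;
      Inc R_pa ;; Inc R_qb ;; Dec R_u)"

lemma runs_row_scan:
  assumes "r R_one = 1" "r R_flag = 0" "r R_u = N"
  shows "runs row_scan r m (N * 12 + 1) (\<lambda>r' m'. m' = m \<and> r' R_pa = r R_pa + N \<and>
    r' R_flag = of_bool (\<exists>u<N. m (r R_pa + u) \<noteq> 0 \<and> m (r R_qb + u) \<noteq> 0) \<and>
    (\<forall>a. a \<notin> {R_pa, R_u, R_qb, R_flag, R_s, R_t} \<longrightarrow> r' a = r a))"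
proof -
  define I where "I j r' m' \<longleftrightarrow> m' = m \<and> r' R_pa = r R_pa + j \<and> r' R_qb = r R_qb + j \<and> r' R_u = N - j \<and>
    r' R_flag = of_bool (\<exists>u<j. m (r R_pa + u) \<noteq> 0 \<and> m (r R_qb + u) \<noteq> 0) \<and>
    (\<forall>a. a \<notin> {R_pa, R_u, R_qb, R_flag, R_s, R_t} \<longrightarrow> r' a = r a)" for j r' and m' :: "nat \<Rightarrow> nat"
  have "runs row_scan r m (N * (11 + 1) + 1) (I N)"
    unfolding row_scan_def
  proof (rule runs_countdown[where I = I])
    show "I 0 r m" using assms by (simp add: I_def)
  next
    fix j r' m' assume "I j r' m'" then show "r' R_u = N - j" by (simp add: I_def)
  next
    fix j r' m' assume "j < N" and I: "I j r' m'"
    then show "runs (Load R_s R_pa ;; Load R_t R_qb ;; IfNZ R_s (IfNZ R_t (Const R_flag 1) Skip) Skip ;;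
      Inc R_pa ;; Inc R_qb ;; Dec R_u) r' m' 11 (I (Suc j))"
      using assms by (intro runs_eff) (auto simp: I_def less_Suc_eq)
  qed
  then show ?thesis by (rule runs_mono) (auto simp: I_def)
qed

text \<open>One pass sums the weights of the vertices and counts the members. The weights are stored
  as well, since the output phase sorts by them. The last \<open>Sub\<close> is non-zero exactly if
  the set has more than \<open>k\<close> vertices.\<close>

definition evaluate :: ram where
  "evaluate =
     (Const R_acc 0 ;; Const R_cnt 0 ;; Copy R_v R_n ;; Copy R_pa R_rows ;; Copy R_pb R_bits ;; Copy R_pc R_cls) ;;
     WhileNZ R_v
       ((Const R_flag 0 ;; Copy R_u R_n ;; Copy R_qb R_bits) ;;
        row_scan ;;
        (Load R_s R_pb ;;
         IfNZ R_s (Inc R_cnt ;; Const R_w 0) (IfNZ R_flag (Copy R_w R_leaf) (Copy R_w R_one)) ;;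
         Add R_acc R_acc R_w ;; Store R_pc R_w ;; Inc R_pb ;; Inc R_pc ;; Dec R_v)) ;;
     (Sub R_s R_cnt R_k ;; IfNZ R_s (Const R_acc 0) Skip)"

text \<open>
  Cell 0 holds \<open>n\<close>, cells \<open>1..n\<close> the values and the next \<open>n * n\<close> cells the matrix. From \<open>bits\<close> on
  there are \<open>n + 1\<close> membership bits, where the last one belongs to the non-vertex \<open>n\<close>: toggling
  the pair \<open>n, v\<close> amounts to toggling \<open>v\<close> alone.
\<close>

locale instance_memory = finite_graph "{..<n}" adj for n :: nat and adj +
  fixes k :: nat and m0 :: "nat \<Rightarrow> nat"
  assumes size: "m0 0 = n"
    and vals: "i < n \<Longrightarrow> m0 (1 + i) \<in> {0, 1}"
    and k: "k = (\<Sum>i<n. m0 (1 + i))"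
    and zeros: "n + 1 + n * n \<le> i \<Longrightarrow> m0 i = 0"
    and matrix: "u < n \<Longrightarrow> v < n \<Longrightarrow> m0 (n + 1 + u * n + v) = of_bool (adj u v)"
begin

definition "bits = n + 1 + n * n"
definition "classes = bits + n + 1"

definition mem :: "nat set \<Rightarrow> (nat \<Rightarrow> nat) \<Rightarrow> bool" where
  "mem D m \<longleftrightarrow> (\<forall>i<bits. m i = m0 i) \<and> (\<forall>v\<le>n. m (bits + v) = of_bool (v \<in> D))"

definition regs :: "(nat \<Rightarrow> nat) \<Rightarrow> bool" where
  "regs r \<longleftrightarrow> r R_zero = 0 \<and> r R_one = 1 \<and> r R_n = n \<and> r R_k = k \<and> r R_rows = n + 1 \<and> r R_bits = bits \<and>
     r R_cls = classes \<and> r R_leaf = n + 2"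

text \<open>Splits the score over the vertices: a leaf counts \<open>n + 1\<close> as a leaf and 1
  as a non-member, an undominated vertex only 1. The three values also identify the three classes of
  vertices.\<close>

definition weight :: "nat set \<Rightarrow> nat \<Rightarrow> nat" where
  "weight D v = (if v \<in> D then 0 else if v \<in> leaves D then n + 2 else 1)"

lemma score_eq_sum_weight:
  "score k D = (if card (D \<inter> {..<n}) \<le> k then (\<Sum>v<n. weight D v) else 0)"
proof -
  have 1: "weight D v = (n + 1) * of_bool (v \<in> leaves D) + of_bool (v \<notin> D)" for v
    by (auto simp: weight_def leaves_def)
  have 2: "leaves D = {v. v < n \<and> v \<in> leaves D}" "{..<n} - D = {v. v < n \<and> v \<notin> D}"
    by (auto simp: leaves_def)
  have "(\<Sum>v<n. weight D v) =
      (n + 1) * (\<Sum>v<n. of_bool (v \<in> leaves D)) + (\<Sum>v<n. of_bool (v \<notin> D))"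
    unfolding 1 sum.distrib sum_distrib_left ..
  also have "\<dots> = (n + 1) * card (leaves D) + card ({..<n} - D)"
  proof -
    have "(\<Sum>v<n. of_bool (v \<in> leaves D)) = card (leaves D)"
      by (subst (2) 2) (simp add: sum_of_bool_eq Int_def)
    moreover have "(\<Sum>v<n. of_bool (v \<notin> D)) = card ({..<n} - D)"
      unfolding 2 by (simp add: sum_of_bool_eq Int_def)
    ultimately show ?thesis by (simp only:)
  qed
  finally show ?thesis by (simp add: score_def)
qed

lemma row_address: "v < n \<Longrightarrow> u < n \<Longrightarrow> n + 1 + v * n + u < bits"
proof -
  assume "v < n" "u < n"
  then have "v * n + u < (v + 1) * n" by simp
  also have "\<dots> \<le> n * n" using \<open>v < n\<close> by (intro mult_le_mono1) simp
  finally show ?thesis by (simp add: bits_def)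
qed

lemma runs_evaluate:
  assumes "regs r" "mem D m"
  shows "runs evaluate r m (n * (n * 12 + 30) + 20) (\<lambda>r' m'. r' R_acc = score k D \<and>
    (\<forall>a<R_acc. r' a = r a) \<and> (\<forall>i. i < classes \<or> classes + n \<le> i \<longrightarrow> m' i = m i) \<and>
    (\<forall>v<n. m' (classes + v) = weight D v))"
proof -
  define I where "I j r' m' \<longleftrightarrow> r' R_acc = (\<Sum>v<j. weight D v) \<and> r' R_cnt = card {v. v < j \<and> v \<in> D} \<and>
    r' R_v = n - j \<and> r' R_pa = n + 1 + j * n \<and> r' R_pb = bits + j \<and> r' R_pc = classes + j \<and>
    (\<forall>a<R_acc. r' a = r a) \<and> (\<forall>i. i < classes \<or> classes + n \<le> i \<longrightarrow> m' i = m i) \<and>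
    (\<forall>v<j. m' (classes + v) = weight D v)" for j r' m'
  have R: "r R_zero = 0" "r R_one = 1" "r R_n = n" "r R_k = k" "r R_rows = n + 1" "r R_bits = bits"
    "r R_cls = classes" "r R_leaf = n + 2"
    using assms by (auto simp: regs_def)
  have "runs evaluate r m (6 + ((n * ((n * 12 + 27) + 1) + 1) + 4)) (\<lambda>r' m'. r' R_acc = score k D \<and>
    (\<forall>a<R_acc. r' a = r a) \<and> (\<forall>i. i < classes \<or> classes + n \<le> i \<longrightarrow> m' i = m i) \<and>
    (\<forall>v<n. m' (classes + v) = weight D v))"
    unfolding evaluate_def
  proof (rule runs_Seq3)
    show "runs (Const R_acc 0 ;; Const R_cnt 0 ;; Copy R_v R_n ;; Copy R_pa R_rows ;; Copy R_pb R_bits ;; Copy R_pc R_cls) r m 6 (I 0)"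
      using R by (intro runs_eff) (auto simp: I_def)
  next
    fix r1 m1 assume "I 0 r1 m1"
    then show "runs (WhileNZ R_v
       ((Const R_flag 0 ;; Copy R_u R_n ;; Copy R_qb R_bits) ;;
        row_scan ;;
        (Load R_s R_pb ;;
         IfNZ R_s (Inc R_cnt ;; Const R_w 0) (IfNZ R_flag (Copy R_w R_leaf) (Copy R_w R_one)) ;;
         Add R_acc R_acc R_w ;; Store R_pc R_w ;; Inc R_pb ;; Inc R_pc ;; Dec R_v))) r1 m1
         (n * ((n * 12 + 27) + 1) + 1) (I n)"
    proof (rule runs_countdown[where I = I])
      fix j r' m' assume "I j r' m'" then show "r' R_v = n - j" by (simp add: I_def)
    next
      fix j r1 m1 assume j: "j < n" and I: "I j r1 m1"
      have R1: "r1 R_zero = 0" "r1 R_one = 1" "r1 R_n = n" "r1 R_bits = bits" "r1 R_leaf = n + 2"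
        using I R by (auto simp: I_def)
      define r2 where "r2 = r1(R_flag := 0, R_u := n, R_qb := bits)"
      have "runs ((Const R_flag 0 ;; Copy R_u R_n ;; Copy R_qb R_bits) ;;
        row_scan ;;
        (Load R_s R_pb ;;
         IfNZ R_s (Inc R_cnt ;; Const R_w 0) (IfNZ R_flag (Copy R_w R_leaf) (Copy R_w R_one)) ;;
         Add R_acc R_acc R_w ;; Store R_pc R_w ;; Inc R_pb ;; Inc R_pc ;; Dec R_v)) r1 m1
         (3 + ((n * 12 + 1) + 12)) (I (Suc j))"
      proof (rule runs_Seq3)
        show "runs (Const R_flag 0 ;; Copy R_u R_n ;; Copy R_qb R_bits) r1 m1 3 (\<lambda>r m. r = r2 \<and> m = m1)"
          using R1 by (intro runs_eff) (auto simp: r2_def)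
      next
        fix r m assume "r = r2 \<and> m = m1"
        then show "runs row_scan r m (n * 12 + 1) (\<lambda>r' m'. m' = m1 \<and> r' R_pa = r2 R_pa + n \<and>
            r' R_flag = of_bool (\<exists>u<n. m1 (r2 R_pa + u) \<noteq> 0 \<and> m1 (r2 R_qb + u) \<noteq> 0) \<and>
            (\<forall>a. a \<notin> {R_pa, R_u, R_qb, R_flag, R_s, R_t} \<longrightarrow> r' a = r2 a))"
          using runs_row_scan[of r2 n m1] R1 by (simp add: r2_def)
      next
        fix r3 m3 assume *: "m3 = m1 \<and> r3 R_pa = r2 R_pa + n \<and>
            r3 R_flag = of_bool (\<exists>u<n. m1 (r2 R_pa + u) \<noteq> 0 \<and> m1 (r2 R_qb + u) \<noteq> 0) \<and>
            (\<forall>a. a \<notin> {R_pa, R_u, R_qb, R_flag, R_s, R_t} \<longrightarrow> r3 a = r2 a)"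
        have row: "m1 (n + 1 + j * n + u) \<noteq> 0 \<longleftrightarrow> adj j u" if "u < n" for u
        proof -
          have "m1 (n + 1 + j * n + u) = m (n + 1 + j * n + u)"
            using I row_address[OF j that] by (simp add: I_def classes_def)
          also have "\<dots> = m0 (n + 1 + j * n + u)"
            using assms(2) row_address[OF j that] by (simp add: mem_def)
          finally show ?thesis using matrix[OF j that] by simp
        qed
        have bit: "m1 (bits + u) \<noteq> 0 \<longleftrightarrow> u \<in> D" if "u < n" for u
        proof -
          have "m1 (bits + u) = m (bits + u)" using I that by (simp add: I_def classes_def)
          then show ?thesis using assms(2) that by (simp add: mem_def)
        qed
        \<comment> \<open>The row of \<open>j\<close> records \<open>adj j u\<close>; symmetry turns
          this into domination of \<open>j\<close> by \<open>u\<close>.\<close>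
        have flag: "r3 R_flag = of_bool (\<exists>u\<in>D. adj u j)"
        proof -
          have "r2 R_pa = n + 1 + j * n" "r2 R_qb = bits" using I by (simp_all add: r2_def I_def)
          then have "r3 R_flag = of_bool (\<exists>u<n. m1 (n + 1 + j * n + u) \<noteq> 0 \<and> m1 (bits + u) \<noteq> 0)"
            using * by (simp only:)
          moreover have "(\<exists>u<n. m1 (n + 1 + j * n + u) \<noteq> 0 \<and> m1 (bits + u) \<noteq> 0) \<longleftrightarrow>
              (\<exists>u<n. adj j u \<and> u \<in> D)"
            using row bit by blast
          moreover have "(\<exists>u<n. adj j u \<and> u \<in> D) \<longleftrightarrow> (\<exists>u\<in>D. adj u j)"
            using adj_sym adj_V by blast
          ultimately show ?thesis by (simp only:)
        qed
        have w: "weight D j = (if j \<in> D then 0 else if \<exists>u\<in>D. adj u j then n + 2 else 1)"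
          using j by (auto simp: weight_def leaves_def)
        have c: "card {v. v < Suc j \<and> v \<in> D} = card {v. v < j \<and> v \<in> D} + of_bool (j \<in> D)"
        proof -
          have "{v. v < Suc j \<and> v \<in> D} =
              (if j \<in> D then insert j {v. v < j \<and> v \<in> D} else {v. v < j \<and> v \<in> D})"
            by (auto simp: less_Suc_eq)
          then show ?thesis by simp
        qed
        have R3: "r3 R_zero = 0" "r3 R_one = 1" "r3 R_leaf = n + 2" "r3 R_pb = bits + j" "r3 R_pc = classes + j"
          "r3 R_v = n - j" "r3 R_acc = (\<Sum>v<j. weight D v)" "r3 R_cnt = card {v. v < j \<and> v \<in> D}"
          "r3 R_pa = n + 1 + Suc j * n" "m3 = m1" "\<forall>a<R_acc. r3 a = r a"
          using * I R by (auto simp: r2_def I_def)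
        have M3: "m3 (bits + j) = of_bool (j \<in> D)" "\<forall>v<j. m1 (classes + v) = weight D v"
            "\<forall>i. i < classes \<or> classes + n \<le> i \<longrightarrow> m1 i = m i"
          using I bit[OF j] j R3 assms(2) by (auto simp: I_def mem_def classes_def)
        show "runs (Load R_s R_pb ;;
           IfNZ R_s (Inc R_cnt ;; Const R_w 0) (IfNZ R_flag (Copy R_w R_leaf) (Copy R_w R_one)) ;;
           Add R_acc R_acc R_w ;; Store R_pc R_w ;; Inc R_pb ;; Inc R_pc ;; Dec R_v) r3 m3 12 (I (Suc j))"
          using j by (intro runs_eff)
            (auto simp: I_def R3 M3[unfolded R3] flag w c All_less_Suc)
      qed
      then show "runs ((Const R_flag 0 ;; Copy R_u R_n ;; Copy R_qb R_bits) ;;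
        row_scan ;;
        (Load R_s R_pb ;;
         IfNZ R_s (Inc R_cnt ;; Const R_w 0) (IfNZ R_flag (Copy R_w R_leaf) (Copy R_w R_one)) ;;
         Add R_acc R_acc R_w ;; Store R_pc R_w ;; Inc R_pb ;; Inc R_pc ;; Dec R_v)) r1 m1
         (n * 12 + 27) (I (Suc j))" by (rule runs_mono) simp_all
    qed
  next
    fix r1 m1 assume I: "I n r1 m1"
    moreover have "{v. v < n \<and> v \<in> D} = D \<inter> {..<n}" by auto
    ultimately show "runs (Sub R_s R_cnt R_k ;; IfNZ R_s (Const R_acc 0) Skip) r1 m1 4 (\<lambda>r' m'. r' R_acc = score k D \<and>
      (\<forall>a<R_acc. r' a = r a) \<and> (\<forall>i. i < classes \<or> classes + n \<le> i \<longrightarrow> m' i = m i) \<and>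
      (\<forall>v<n. m' (classes + v) = weight D v))"
      using R by (intro runs_eff) (auto simp: I_def score_eq_sum_weight)
  qed
  then show ?thesis by (rule runs_mono) (simp_all add: distrib_left)
qed

end

section \<open>The search over pairs of toggles\<close>

definition toggle_bit :: "nat \<Rightarrow> ram" where
  "toggle_bit a = Add R_s R_bits a ;; Load R_t R_s ;; Sub R_t R_one R_t ;; Store R_s R_t"

text \<open>Tries every \<open>y \<le> n\<close>, the dummy included, and toggles it back after each
  trial. Only a strict improvement replaces the recorded best.\<close>

definition best_partner :: ram where
  "best_partner = WhileNZ R_y
     (Dec R_y ;; toggle_bit R_y ;; evaluate ;;
      (Sub R_s R_acc R_best ;; IfNZ R_s (Copy R_best R_acc ;; Copy R_by R_y) Skip) ;;
      toggle_bit R_y)"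

text \<open>\<open>x\<close> runs downwards from the dummy \<open>n\<close>, so all single toggles
  come before proper pairs, and every improvement restarts the scan. \<open>R_by\<close> starts as
  \<open>x\<close>: if no partner improves, toggling it undoes the toggle of
  \<open>x\<close>.\<close>

definition local_search :: ram where
  "local_search = WhileNZ R_x
     (Dec R_x ;; toggle_bit R_x ;;
      (Copy R_best R_cur ;; Copy R_by R_x ;; Copy R_y R_rows) ;;
      best_partner ;; toggle_bit R_by ;;
      (Sub R_s R_best R_cur ;; IfNZ R_s (Copy R_cur R_best ;; Copy R_x R_rows) Skip))"

abbreviation "eval_time n \<equiv> n * (n * 12 + 30) + (20 :: nat)"
abbreviation "step_time n \<equiv> (n + 1) * (eval_time n + 20) + (20 :: nat)"

context instance_memory
begin

text \<open>The registers below \<open>R_cur\<close> hold the constants of the instance; the search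
  writes only to later ones.\<close>

lemma regs_cong: "regs r \<Longrightarrow> \<forall>a<R_cur. r' a = r a \<Longrightarrow> regs r'"
  by (simp add: regs_def)

lemma mem_cong: "mem D m \<Longrightarrow> \<forall>i<classes. m' i = m i \<Longrightarrow> mem D m'"
  by (auto simp: mem_def classes_def)

lemma runs_toggle_bit:
  assumes "regs r" "mem D m" "r a \<le> n" "a < R_s"
  shows "runs (toggle_bit a) r m 4 (\<lambda>r' m'. mem (toggle (r a) D) m' \<and> (\<forall>b<R_acc. r' b = r b))"
  unfolding toggle_bit_def
  using assms by (intro runs_eff) (auto simp: regs_def mem_def toggle_def)

lemma runs_best_partner:
  assumes "regs r" "mem D m" "r R_y = n + 1"
  shows "runs best_partner r m ((n + 1) * (eval_time n + 20) + 1) (\<lambda>r' m'.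
    mem D m' \<and> (\<forall>a<R_best. r' a = r a) \<and>
    (\<forall>y\<le>n. score k (toggle y D) \<le> r' R_best) \<and>
    (r' R_best = r R_best \<and> r' R_by = r R_by \<or>
     r R_best < r' R_best \<and> r' R_by \<le> n \<and> score k (toggle (r' R_by) D) = r' R_best))"
proof -
  define I where "I j r' m' \<longleftrightarrow> r' R_y = n + 1 - j \<and> mem D m' \<and> (\<forall>a<R_best. r' a = r a) \<and>
    (\<forall>y\<le>n. n + 1 - j \<le> y \<longrightarrow> score k (toggle y D) \<le> r' R_best) \<and>
    (r' R_best = r R_best \<and> r' R_by = r R_by \<or>
     r R_best < r' R_best \<and> r' R_by \<le> n \<and> score k (toggle (r' R_by) D) = r' R_best)" for j r' m'
  have "runs best_partner r m ((n + 1) * ((eval_time n + 19) + 1) + 1) (I (n + 1))"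
    unfolding best_partner_def
  proof (rule runs_countdown[where I = I])
    show "I 0 r m" using assms by (auto simp: I_def)
  next
    fix j r' m' assume "I j r' m'" then show "r' R_y = n + 1 - j" by (simp add: I_def)
  next
    fix j r1 m1 assume j: "j < n + 1" and I: "I j r1 m1"
    define y where "y = n - j"
    have y: "y \<le> n" "y = n + 1 - Suc j" by (simp_all add: y_def)
    have regs1: "regs r1" by (rule regs_cong[OF assms(1)]) (use I in \<open>simp add: I_def\<close>)
    define r2 where "r2 = r1(R_y := y)"
    have regs2: "regs r2" by (rule regs_cong[OF regs1]) (simp add: r2_def)
    define r5 where "r5 = (if r2 R_best < score k (toggle y D)
      then r2(R_best := score k (toggle y D), R_by := y) else r2)"
    have "runs (Dec R_y ;; toggle_bit R_y ;; evaluate ;;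
      (Sub R_s R_acc R_best ;; IfNZ R_s (Copy R_best R_acc ;; Copy R_by R_y) Skip) ;;
      toggle_bit R_y) r1 m1 (1 + (4 + (eval_time n + (5 + 4)))) (I (Suc j))"
    proof (rule runs_Seq3)
      show "runs (Dec R_y) r1 m1 1 (\<lambda>r m. r = r2 \<and> m = m1)"
        using I regs1 j by (intro runs_eff) (auto simp: r2_def I_def regs_def y_def)
    next
      fix r m assume "r = r2 \<and> m = m1"
      then show "runs (toggle_bit R_y) r m 4 (\<lambda>r' m'. mem (toggle y D) m' \<and> (\<forall>b<R_acc. r' b = r2 b))"
        using runs_toggle_bit[OF regs2, of D m1 R_y] y I by (simp add: r2_def I_def)
    next
      fix r3 m3 assume 3: "mem (toggle y D) m3 \<and> (\<forall>b<R_acc. r3 b = r2 b)"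
      then have regs3: "regs r3" by (intro regs_cong[OF regs2]) simp
      show "runs (evaluate ;;
        (Sub R_s R_acc R_best ;; IfNZ R_s (Copy R_best R_acc ;; Copy R_by R_y) Skip) ;;
        toggle_bit R_y) r3 m3 (eval_time n + (5 + 4)) (I (Suc j))"
      proof (rule runs_Seq3)
        show "runs evaluate r3 m3 (eval_time n) (\<lambda>r' m'. r' R_acc = score k (toggle y D) \<and>
            (\<forall>a<R_acc. r' a = r2 a) \<and> mem (toggle y D) m')"
        proof (rule runs_mono[OF runs_evaluate[OF regs3]])
          show "mem (toggle y D) m3" using 3 by simp
        next
          fix r' m' assume "r' R_acc = score k (toggle y D) \<and>
            (\<forall>a<R_acc. r' a = r3 a) \<and> (\<forall>i. i < classes \<or> classes + n \<le> i \<longrightarrow> m' i = m3 i) \<and>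
            (\<forall>v<n. m' (classes + v) = weight (toggle y D) v)"
          then show "r' R_acc = score k (toggle y D) \<and>
            (\<forall>a<R_acc. r' a = r2 a) \<and> mem (toggle y D) m'"
            using 3 mem_cong[of "toggle y D" m3 m'] by auto
        qed simp
      next
        fix r4 m4 assume 4: "r4 R_acc = score k (toggle y D) \<and>
            (\<forall>a<R_acc. r4 a = r2 a) \<and> mem (toggle y D) m4"
        have r4: "r4 R_zero = 0" "r4 R_y = y" using 4 regs2 by (simp_all add: regs_def r2_def)
        show "runs (Sub R_s R_acc R_best ;; IfNZ R_s (Copy R_best R_acc ;; Copy R_by R_y) Skip)
          r4 m4 5 (\<lambda>r m. (\<forall>a<R_acc. r a = r5 a) \<and> mem (toggle y D) m)"
          using r4 4 by (intro runs_eff) (auto simp: r5_def)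
      next
        fix r6 m6 assume 6: "(\<forall>a<R_acc. r6 a = r5 a) \<and> mem (toggle y D) m6"
        have r5: "\<forall>a<R_best. r5 a = r2 a" "r5 R_y = y" by (simp_all add: r5_def r2_def)
        have regs6: "regs r6" using 6 r5 by (intro regs_cong[OF regs2]) simp
        show "runs (toggle_bit R_y) r6 m6 4 (I (Suc j))"
        proof (rule runs_mono[OF runs_toggle_bit[OF regs6]])
          show "mem (toggle y D) m6" "r6 R_y \<le> n" using 6 r5 y by simp_all
        next
          fix r' m' assume "mem (toggle (r6 R_y) (toggle y D)) m' \<and> (\<forall>b<R_acc. r' b = r6 b)"
          then have 7: "mem D m'" "\<forall>b<R_acc. r' b = r5 b" using 6 r5 by auto
          have best: "r2 R_best = r1 R_best" "r2 R_by = r1 R_by" by (simp_all add: r2_def)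
          have "r' R_best = max (r1 R_best) (score k (toggle y D))"
            using 7 best by (simp add: r5_def)
          moreover have "score k (toggle z D) \<le> max (r1 R_best) (score k (toggle y D))"
            if "z \<le> n" "y \<le> z" for z
          proof (cases "z = y")
            case False
            then have "n + 1 - j \<le> z" using that j by (simp add: y_def)
            then show ?thesis using I that by (auto simp: I_def intro: le_trans)
          qed simp
          moreover have "r' R_best = r R_best \<and> r' R_by = r R_by \<or>
            r R_best < r' R_best \<and> r' R_by \<le> n \<and> score k (toggle (r' R_by) D) = r' R_best"
            using 7 best I y by (auto simp: r5_def I_def)
          moreover have "\<forall>a<R_best. r' a = r a" using 7 r5 I by (simp add: r2_def I_def)
          ultimately show "I (Suc j) r' m'"
            using 7 r5 y by (simp add: I_def)
        qed simp_all
      qed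
    qed
    then show "runs (Dec R_y ;; toggle_bit R_y ;; evaluate ;;
      (Sub R_s R_acc R_best ;; IfNZ R_s (Copy R_best R_acc ;; Copy R_by R_y) Skip) ;;
      toggle_bit R_y) r1 m1 (eval_time n + 19) (I (Suc j))" by (rule runs_mono) simp_all
  qed
  then show ?thesis by (rule runs_mono) (auto simp: I_def)
qed

text \<open>Limits the number of improvements, since each raises the score.\<close>

lemma score_bound: "score k D \<le> (n + 1) * (n + 1)"
proof -
  have "card (leaves D) \<le> n" using card_mono[of "{..<n}" "leaves D"] by (auto simp: leaves_def)
  then have "(n + 1) * card (leaves D) \<le> (n + 1) * n" by (rule mult_le_mono2)
  moreover have "card ({..<n} - D) \<le> n" using card_mono[of "{..<n}" "{..<n} - D"] by auto
  ultimately have "(n + 1) * card (leaves D) + card ({..<n} - D) \<le> (n + 1) * n + n"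
    by (rule add_mono)
  then show ?thesis by (simp add: score_def)
qed

text \<open>If \<open>x\<close> is the dummy, the pair is a best single toggle. Otherwise the dummy
  was tested before, so no single toggle improves and the second alternative of \<open>step\<close>
  holds.\<close>

lemma search_path_toggle_pair:
  assumes path: "search_path k D" and x: "x \<le> n"
    and tested: "\<forall>x' y. x < x' \<longrightarrow> x' \<le> n \<longrightarrow> y \<le> n \<longrightarrow> score k (toggle y (toggle x' D)) \<le> score k D"
    and best: "\<forall>y'\<le>n. score k (toggle y' (toggle x D)) \<le> score k (toggle y (toggle x D))"
    and better: "score k D < score k (toggle y (toggle x D))"
  shows "search_path k (toggle y (toggle x D))"
proof (cases "x = n")
  case True
  then have x: "x \<notin> {..<n}" by simp
  show ?thesis
  proof (rule search_path.step[OF path better])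
    fix v assume "v \<in> {..<n}"
    then show "score k (toggle v D) \<le> score k (toggle y (toggle x D))"
      using best score_toggle_outside[OF x] by (metis lessThan_iff less_imp_le)
  next
    have "toggle y (toggle x D) \<inter> {..<n} \<subseteq> insert y (D \<inter> {..<n})"
      using x by (auto simp: toggle_def split: if_splits)
    then have "card (toggle y (toggle x D) \<inter> {..<n}) \<le> card (insert y (D \<inter> {..<n}))"
      by (intro card_mono) auto
    also have "\<dots> \<le> card (D \<inter> {..<n}) + 1" by (simp add: card_insert_if)
    finally show "card (toggle y (toggle x D) \<inter> {..<n}) \<le> card (D \<inter> {..<n}) + 1 \<or>
      (\<forall>v\<in>{..<n}. score k (toggle v D) \<le> score k D)" ..
  qed
next
  case False
  have single: "score k (toggle v D) \<le> score k D" if "v < n" for v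
    using tested[rule_format, of n v] False x that score_toggle_outside[of n k v D] by simp
  show ?thesis
  proof (rule search_path.step[OF path better])
    fix v assume "v \<in> {..<n}"
    then show "score k (toggle v D) \<le> score k (toggle y (toggle x D))"
      using single[of v] better by simp
  qed (use single in auto)
qed

lemma runs_local_search:
  assumes "regs r" "mem {} m" "r R_x = n + 1" "r R_cur = n"
  shows "runs local_search r m (((n + 1) * (n + 1) * (n + 2) + n + 1) * (step_time n + 1) + 1) (\<lambda>r' m'.
    regs r' \<and> (\<exists>D. mem D m' \<and> search_path k D \<and> locally_optimal k D))"
proof -
  \<comment> \<open>By the last condition, pairs whose first element was already scanned do not
    improve; at \<open>R_x = 0\<close> this is local optimality.\<close>
  define P where "P D r m \<longleftrightarrow> mem D m \<and> regs r \<and> r R_x \<le> n + 1 \<and> r R_cur = score k D \<and>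
    search_path k D \<and> (\<forall>x y. r R_x \<le> x \<longrightarrow> x \<le> n \<longrightarrow> y \<le> n \<longrightarrow>
      score k (toggle y (toggle x D)) \<le> score k D)" for D r m
  \<comment> \<open>A lexicographic measure: an improvement lowers the first part by at least
    \<open>n + 2\<close>, more than the reset of \<open>R_x\<close> to \<open>n + 1\<close> can add.
    Otherwise \<open>R_x\<close> drops.\<close>
  define \<mu> where "\<mu> r m = ((n + 1) * (n + 1) - r R_cur) * (n + 2) + r R_x"
    for r and m :: "nat \<Rightarrow> nat"
  have "runs local_search r m (\<mu> r m * (step_time n + 1) + 1)
      (\<lambda>r' m'. (\<exists>D. P D r' m') \<and> r' R_x = 0)"
    unfolding local_search_def
  proof (rule runs_While)
    \<comment> \<open>Hence the empty set has score \<open>n\<close>, the initial value of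
      \<open>R_cur\<close>.\<close>
    have "leaves {} = {}" by (auto simp: leaves_def)
    then have "P {} r m" using assms by (simp add: P_def search_path.start score_def)
    then show "\<exists>D. P D r m" ..
  next
    fix r1 m1 assume "\<exists>D. P D r1 m1" and nz: "r1 R_x \<noteq> 0"
    then obtain D where P: "P D r1 m1" by auto
    define x where "x = r1 R_x - 1"
    have x: "x \<le> n" "r1 R_x = x + 1" using P nz by (auto simp: P_def x_def)
    have regs1: "regs r1" using P by (simp add: P_def)
    have tested: "\<forall>x' y. x < x' \<longrightarrow> x' \<le> n \<longrightarrow> y \<le> n \<longrightarrow> score k (toggle y (toggle x' D)) \<le> score k D"
      using P x by (simp add: P_def)
    let ?Q = "\<lambda>r' m'. (\<exists>D. P D r' m') \<and> \<mu> r' m' < \<mu> r1 m1"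
    define r2 where "r2 = r1(R_x := x)"
    have regs2: "regs r2" by (rule regs_cong[OF regs1]) (simp add: r2_def)
    have "runs (Dec R_x ;; toggle_bit R_x ;;
      (Copy R_best R_cur ;; Copy R_by R_x ;; Copy R_y R_rows) ;;
      best_partner ;; toggle_bit R_by ;;
      (Sub R_s R_best R_cur ;; IfNZ R_s (Copy R_cur R_best ;; Copy R_x R_rows) Skip)) r1 m1
      (1 + (4 + (3 + (((n + 1) * (eval_time n + 20) + 1) + (4 + 5))))) ?Q"
    proof (rule runs_Seq3)
      show "runs (Dec R_x) r1 m1 1 (\<lambda>r m. r = r2 \<and> m = m1)"
        using x regs1 by (intro runs_eff) (auto simp: r2_def regs_def)
    next
      fix r m assume "r = r2 \<and> m = m1"
      then show "runs (toggle_bit R_x) r m 4 (\<lambda>r' m'. mem (toggle x D) m' \<and> (\<forall>b<R_acc. r' b = r2 b))"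
        using runs_toggle_bit[OF regs2, of D m1 R_x] x P by (simp add: r2_def P_def)
    next
      fix r3 m3 assume 3: "mem (toggle x D) m3 \<and> (\<forall>b<R_acc. r3 b = r2 b)"
      define r4 where "r4 = r3(R_best := score k D, R_by := x, R_y := n + 1)"
      have r3: "r3 R_zero = 0" "r3 R_rows = n + 1" "r3 R_cur = score k D" "r3 R_x = x"
        using 3 regs2 P by (simp_all add: regs_def r2_def P_def)
      have regs4: "regs r4" by (rule regs_cong[OF regs2]) (use 3 in \<open>simp add: r4_def\<close>)
      show "runs ((Copy R_best R_cur ;; Copy R_by R_x ;; Copy R_y R_rows) ;;
        best_partner ;; toggle_bit R_by ;;
        (Sub R_s R_best R_cur ;; IfNZ R_s (Copy R_cur R_best ;; Copy R_x R_rows) Skip)) r3 m3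
        (3 + (((n + 1) * (eval_time n + 20) + 1) + (4 + 5))) ?Q"
      proof (rule runs_Seq3)
        show "runs (Copy R_best R_cur ;; Copy R_by R_x ;; Copy R_y R_rows) r3 m3 3
            (\<lambda>r m. r = r4 \<and> m = m3)"
          using r3 by (intro runs_eff) (auto simp: r4_def)
      next
        fix r m assume "r = r4 \<and> m = m3"
        then show "runs best_partner r m ((n + 1) * (eval_time n + 20) + 1) (\<lambda>r' m'.
            mem (toggle x D) m' \<and> (\<forall>a<R_best. r' a = r4 a) \<and>
            (\<forall>y\<le>n. score k (toggle y (toggle x D)) \<le> r' R_best) \<and>
            (r' R_best = score k D \<and> r' R_by = x \<or> score k D < r' R_best \<and> r' R_by \<le> n \<and>
              score k (toggle (r' R_by) (toggle x D)) = r' R_best))"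
          using runs_best_partner[OF regs4, of "toggle x D" m3] 3 by (simp add: r4_def)
      next
        fix r5 m5 assume 5: "mem (toggle x D) m5 \<and> (\<forall>a<R_best. r5 a = r4 a) \<and>
            (\<forall>y\<le>n. score k (toggle y (toggle x D)) \<le> r5 R_best) \<and>
            (r5 R_best = score k D \<and> r5 R_by = x \<or> score k D < r5 R_best \<and> r5 R_by \<le> n \<and>
              score k (toggle (r5 R_by) (toggle x D)) = r5 R_best)"
        have regs5: "regs r5" by (rule regs_cong[OF regs4]) (use 5 in simp)
        have r5: "r5 R_x = x" "r5 R_cur = score k D" using 5 r3 by (simp_all add: r4_def)
        define D' where "D' = toggle (r5 R_by) (toggle x D)"
        show "runs (toggle_bit R_by ;;
          (Sub R_s R_best R_cur ;; IfNZ R_s (Copy R_cur R_best ;; Copy R_x R_rows) Skip)) r5 m5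
          (4 + 5) ?Q"
        proof (rule runs_Seq)
          show "runs (toggle_bit R_by) r5 m5 4 (\<lambda>r' m'. mem D' m' \<and> (\<forall>b<R_acc. r' b = r5 b))"
            using runs_toggle_bit[OF regs5, of "toggle x D" m5 R_by] 5 x by (auto simp: D'_def)
        next
          fix r6 m6 assume 6: "mem D' m6 \<and> (\<forall>b<R_acc. r6 b = r5 b)"
          have r6: "r6 R_zero = 0" "r6 R_rows = n + 1" "r6 R_best = r5 R_best" "r6 R_x = x"
              "r6 R_cur = score k D"
            using 6 regs5 r5 by (simp_all add: regs_def)
          have regs6: "regs r6" by (rule regs_cong[OF regs5]) (use 6 in simp)
          define r7 where "r7 = (if score k D < r5 R_best
            then r6(R_s := r5 R_best - score k D, R_cur := r5 R_best, R_x := n + 1)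
            else r6(R_s := r5 R_best - score k D))"
          have "?Q r7 m6"
          proof (cases "score k D < r5 R_best")
            case True
            then have D': "score k D' = r5 R_best" using 5 by (auto simp: D'_def)
            have "search_path k D'"
              unfolding D'_def
              using P 5 True D' x tested by (intro search_path_toggle_pair) (auto simp: P_def D'_def)
            moreover have "regs r7" by (rule regs_cong[OF regs6]) (simp add: r7_def)
            ultimately have "P D' r7 m6" using 6 True D' by (simp add: P_def r7_def)
            moreover have "\<mu> r7 m6 < \<mu> r1 m1"
            proof -
              have "r5 R_best \<le> (n + 1) * (n + 1)" using score_bound[of D'] D' by simp
              then obtain e where e: "(n + 1) * (n + 1) = r5 R_best + e" using le_Suc_ex by blast
              obtain d where d: "r5 R_best = score k D + Suc d" using True less_imp_Suc_add by auto
              have "\<mu> r7 m6 = e * (n + 2) + (n + 1)" using True e by (simp add: \<mu>_def r7_def)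
              also have "\<dots> < (Suc d + e) * (n + 2)" by (simp add: add_mult_distrib)
              also have "\<dots> \<le> \<mu> r1 m1" using P by (simp only: \<mu>_def e d P_def) simp
              finally show ?thesis .
            qed
            ultimately show ?thesis by blast
          next
            case False
            \<comment> \<open>No partner improved, so \<open>R_by\<close> is still \<open>x\<close>
              and the two toggles cancel.\<close>
            then have part: "r5 R_by = x" "r5 R_best = score k D" using 5 by auto
            then have D': "D' = D" by (simp add: D'_def)
            have r7: "r7 R_x = x" "r7 R_cur = score k D" using False r6 by (simp_all add: r7_def)
            have "score k (toggle y (toggle x' D)) \<le> score k D" if "x \<le> x'" "x' \<le> n" "y \<le> n" for x' y
              using tested 5 by (metis part(2) that le_neq_implies_less)
            moreover have "regs r7" by (rule regs_cong[OF regs6]) (use False in \<open>simp add: r7_def\<close>)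
            ultimately have "P D r7 m6" using P 6 D' r7 x by (simp add: P_def)
            moreover have "\<mu> r7 m6 < \<mu> r1 m1" using P r7 x by (simp add: \<mu>_def P_def)
            ultimately show ?thesis by blast
          qed
          then show "runs (Sub R_s R_best R_cur ;;
            IfNZ R_s (Copy R_cur R_best ;; Copy R_x R_rows) Skip) r6 m6 5 ?Q"
            using r6 by (intro runs_eff) (auto simp: r7_def split: if_splits)
        qed
      qed
    qed
    then show "runs (Dec R_x ;; toggle_bit R_x ;;
      (Copy R_best R_cur ;; Copy R_by R_x ;; Copy R_y R_rows) ;;
      best_partner ;; toggle_bit R_by ;;
      (Sub R_s R_best R_cur ;; IfNZ R_s (Copy R_cur R_best ;; Copy R_x R_rows) Skip)) r1 m1
      (step_time n) ?Q" by (rule runs_mono) simp_all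
  qed
  then show ?thesis
  proof (rule runs_mono)
    have "\<mu> r m \<le> (n + 1) * (n + 1) * (n + 2) + n + 1"
      unfolding \<mu>_def assms(3,4) add.assoc
      by (intro add_right_mono mult_le_mono1 diff_le_self)
    then show "\<mu> r m * (step_time n + 1) + 1 \<le> ((n + 1) * (n + 1) * (n + 2) + n + 1) * (step_time n + 1) + 1"
      by (intro add_mono mult_le_mono1) auto
  next
    fix r' m' assume "(\<exists>D. P D r' m') \<and> r' R_x = 0"
    then obtain D where D: "P D r' m'" "r' R_x = 0" by auto
    then have *: "score k (toggle y (toggle x D)) \<le> score k D" if "x \<le> n" "y \<le> n" for x y
      using that by (simp add: P_def)
    \<comment> \<open>The instance \<open>x = n\<close> of \<open>*\<close> covers the single
      toggles.\<close>
    then have "locally_optimal k D"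
      unfolding locally_optimal_def using score_toggle_outside[of n k _ D] *[of n] by auto
    then show "regs r' \<and> (\<exists>D. mem D m' \<and> search_path k D \<and> locally_optimal k D)"
      using D by (auto simp: P_def)
  qed
qed

end

section \<open>Reading the input and writing the allocation\<close>

text \<open>The machine cannot multiply, so \<open>n * n\<close> is accumulated in
  \<open>R_bits\<close> by one addition per object, in the loop that sums the values to
  \<open>k\<close>.\<close>

definition read_input :: ram where
  "read_input =
     (Const R_one 1 ;; Load R_n R_zero ;; Copy R_rows R_one ;; Copy R_v R_n) ;;
     WhileNZ R_v
       (Load R_s R_rows ;; Add R_k R_k R_s ;; Inc R_rows ;; Add R_bits R_bits R_n ;; Dec R_v) ;;
     (Add R_bits R_bits R_rows ;; Add R_cls R_bits R_rows ;; Add R_leaf R_rows R_one ;;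
      Copy R_cur R_n ;; Copy R_x R_rows)"

text \<open>One bucket of a bucket sort, appended at \<open>R_pc\<close>. The two truncated
  differences add up to 0 exactly if the cell equals \<open>R_w\<close>.\<close>

definition collect :: "nat \<Rightarrow> ram" where
  "collect src =
     (Copy R_v R_n ;; Copy R_pa src ;; Const R_cnt 0) ;;
     WhileNZ R_v
       (Load R_s R_pa ;; Sub R_t R_s R_w ;; Sub R_s R_w R_s ;; Add R_t R_t R_s ;;
        IfNZ R_t Skip (Store R_pc R_cnt ;; Inc R_pc) ;;
        Inc R_pa ;; Inc R_cnt ;; Dec R_v)"

definition assign :: ram where
  "assign = Copy R_v R_n ;; 
     WhileNZ R_v
       (Load R_s R_best ;; Load R_t R_by ;; Store R_t R_s ;; Inc R_best ;; Inc R_by ;; Dec R_v)"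

definition holds_list :: "(nat \<Rightarrow> nat) \<Rightarrow> nat \<Rightarrow> nat list \<Rightarrow> bool" where
  "holds_list m q xs \<longleftrightarrow> (\<forall>j<length xs. m (q + j) = xs ! j)"

lemma holds_list_append:
  "holds_list m q (xs @ ys) \<longleftrightarrow> holds_list m q xs \<and> holds_list m (q + length xs) ys"
proof -
  have "(\<forall>j<length xs + length ys. m (q + j) = (xs @ ys) ! j) \<longleftrightarrow>
      (\<forall>j<length xs. m (q + j) = xs ! j) \<and> (\<forall>j<length ys. m (q + (length xs + j)) = ys ! j)"
    (is "?l \<longleftrightarrow> ?r")
  proof
    assume l: ?l
    have "m (q + j) = xs ! j" if "j < length xs" for j
      using l[rule_format, of j] that by (simp add: nth_append)
    moreover have "m (q + (length xs + j)) = ys ! j" if "j < length ys" for j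
      using l[rule_format, of "length xs + j"] that by simp
    ultimately show ?r by blast
  next
    assume r: ?r
    show ?l
    proof (intro allI impI)
      fix j assume j: "j < length xs + length ys"
      show "m (q + j) = (xs @ ys) ! j"
      proof (cases "j < length xs")
        case False
        then show ?thesis using r[THEN conjunct2, rule_format, of "j - length xs"] j
          by (simp add: nth_append)
      qed (use r in \<open>simp add: nth_append\<close>)
    qed
  qed
  then show ?thesis by (simp add: holds_list_def add.assoc)
qed

lemma holds_list_cong:
  "holds_list m q xs \<Longrightarrow> (\<And>i. q \<le> i \<Longrightarrow> i < q + length xs \<Longrightarrow> m' i = m i) \<Longrightarrow> holds_list m' q xs"
  by (simp add: holds_list_def)

text \<open>The last premise keeps the source cells clear of the cells being written.\<close>

lemma runs_collect:
  assumes "r R_zero = 0" "r R_one = 1" "r R_n = N" "src < R_acc" "r src + N \<le> r R_pc"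
  shows "runs (collect src) r m (N * 13 + 4) (\<lambda>r' m'.
    let xs = filter (\<lambda>i. m (r src + i) = r R_w) [0..<N] in
      holds_list m' (r R_pc) xs \<and> r' R_pc = r R_pc + length xs \<and> (\<forall>i<r R_pc. m' i = m i) \<and>
      (\<forall>a<R_acc. r' a = r a))"
proof -
  define xs where "xs j = filter (\<lambda>i. m (r src + i) = r R_w) [0..<j]" for j
  define I where "I j r' m' \<longleftrightarrow> r' R_v = N - j \<and> r' R_pa = r src + j \<and> r' R_cnt = j \<and>
    r' R_w = r R_w \<and> holds_list m' (r R_pc) (xs j) \<and> r' R_pc = r R_pc + length (xs j) \<and>
    (\<forall>i<r R_pc. m' i = m i) \<and> (\<forall>a<R_acc. r' a = r a)" for j r' m'
  have "runs (collect src) r m (3 + (N * (12 + 1) + 1)) (I N)"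
    unfolding collect_def
  proof (rule runs_Seq)
    show "runs (Copy R_v R_n ;; Copy R_pa src ;; Const R_cnt 0) r m 3 (I 0)"
      using assms by (intro runs_eff) (auto simp: I_def xs_def holds_list_def)
  next
    fix r1 m1 assume "I 0 r1 m1"
    then show "runs (WhileNZ R_v
       (Load R_s R_pa ;; Sub R_t R_s R_w ;; Sub R_s R_w R_s ;; Add R_t R_t R_s ;;
        IfNZ R_t Skip (Store R_pc R_cnt ;; Inc R_pc) ;;
        Inc R_pa ;; Inc R_cnt ;; Dec R_v)) r1 m1 (N * (12 + 1) + 1) (I N)"
    proof (rule runs_countdown[where I = I])
      fix j r' m' assume "I j r' m'" then show "r' R_v = N - j" by (simp add: I_def)
    next
      fix j r1 m1 assume j: "j < N" and I: "I j r1 m1"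
      have r1: "r1 R_zero = 0" "r1 R_one = 1" using I assms by (simp_all add: I_def)
      have m1: "m1 (r src + j) = m (r src + j)" using I assms j by (simp add: I_def)
      have xs: "xs (Suc j) = (if m (r src + j) = r R_w then xs j @ [j] else xs j)"
        by (simp add: xs_def)
      have eq: "x - y + (y - x) = 0 \<longleftrightarrow> x = y" for x y :: nat by auto
      show "runs (Load R_s R_pa ;; Sub R_t R_s R_w ;; Sub R_s R_w R_s ;; Add R_t R_t R_s ;;
        IfNZ R_t Skip (Store R_pc R_cnt ;; Inc R_pc) ;;
        Inc R_pa ;; Inc R_cnt ;; Dec R_v) r1 m1 12 (I (Suc j))"
      proof (cases "m (r src + j) = r R_w")
        case True
        have "holds_list (m1(r R_pc + length (xs j) := j)) (r R_pc) (xs j @ [j])"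
          unfolding holds_list_append using I
          by (auto simp: I_def holds_list_def)
        then show ?thesis
          using I r1 m1 True xs by (intro runs_eff) (simp_all add: I_def)
      next
        case False
        then show ?thesis
          using I r1 m1 xs by (intro runs_eff) (simp_all add: I_def)
      qed
    qed
  qed
  then show ?thesis by (rule runs_mono) (simp_all add: I_def xs_def)
qed

lemma runs_assign:
  assumes "r R_zero = 0" "r R_one = 1" "r R_n = N"
    and xs: "holds_list m (r R_best) xs" "length xs = N" "N \<le> r R_best"
    and ys: "holds_list m (r R_by) ys" "length ys = N" "N \<le> r R_by" "distinct ys" "set ys \<subseteq> {..<N}"
  shows "runs assign r m (N * 7 + 2) (\<lambda>r' m'. \<forall>j<N. m' (ys ! j) = xs ! j)"
proof -
  define I where "I j r' m' \<longleftrightarrow> r' R_v = N - j \<and> r' R_one = 1 \<and> r' R_best = r R_best + j \<and>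
    r' R_by = r R_by + j \<and> (\<forall>i\<ge>N. m' i = m i) \<and> (\<forall>i<j. m' (ys ! i) = xs ! i)" for j r' m'
  have "runs assign r m (1 + (N * (6 + 1) + 1)) (I N)"
    unfolding assign_def
  proof (rule runs_Seq)
    show "runs (Copy R_v R_n) r m 1 (I 0)" using assms by (intro runs_eff) (auto simp: I_def)
  next
    fix r1 m1 assume "I 0 r1 m1"
    then show "runs (WhileNZ R_v
       (Load R_s R_best ;; Load R_t R_by ;; Store R_t R_s ;; Inc R_best ;; Inc R_by ;; Dec R_v))
       r1 m1 (N * (6 + 1) + 1) (I N)"
    proof (rule runs_countdown[where I = I])
      fix j r' m' assume "I j r' m'" then show "r' R_v = N - j" by (simp add: I_def)
    next
      fix j r1 m1 assume j: "j < N" and I: "I j r1 m1"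
      have m1: "m1 (r R_best + j) = xs ! j" "m1 (r R_by + j) = ys ! j"
        using I j xs ys by (simp_all add: I_def holds_list_def)
      \<comment> \<open>Writing below \<open>N\<close> spares both lists, which start at
        \<open>N\<close> or later; distinctness of \<open>ys\<close> protects the earlier
        entries.\<close>
      have "ys ! j < N" using ys(2,5) j nth_mem[of j ys] by blast
      moreover have "ys ! i \<noteq> ys ! j" if "i < j" for i
        using ys j that by (simp add: nth_eq_iff_index_eq)
      ultimately show "runs (Load R_s R_best ;; Load R_t R_by ;; Store R_t R_s ;; Inc R_best ;;
          Inc R_by ;; Dec R_v) r1 m1 6 (I (Suc j))"
        using I m1 by (intro runs_eff) (auto simp: I_def less_Suc_eq)
    qed
  qed
  then show ?thesis by (rule runs_mono) (simp_all add: I_def)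
qed

text \<open>Pairs two lists in order: objects of value 1 before those of value 0, and vertices of
  the set, then undominated ones, then leaves. \<open>R_one\<close> doubles as the address 1 of the
  first value.\<close>

definition output_allocation :: ram where
  "output_allocation =
     evaluate ;;
     (Add R_best R_cls R_n ;; Copy R_pc R_best) ;;
     (Const R_w 1 ;; collect R_one) ;;
     (Const R_w 0 ;; collect R_one) ;;
     Copy R_by R_pc ;;
     (Const R_w 0 ;; collect R_cls) ;;
     (Const R_w 1 ;; collect R_cls) ;;
     (Copy R_w R_leaf ;; collect R_cls) ;;
     assign"

definition opt_ext_program :: ram where
  "opt_ext_program = read_input ;; local_search ;; output_allocation"

definition total_time :: "nat \<Rightarrow> nat" where
  "total_time n = (n * 6 + 10) +
     ((((n + 1) * (n + 1) * (n + 2) + n + 1) * (step_time n + 1) + 1) +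
      (eval_time n + 5 * (n * 13 + 4) + (n * 7 + 2) + 20))"

context instance_memory
begin

lemma runs_read_input:
  "runs read_input (\<lambda>_. 0) m0 (n * 6 + 10) (\<lambda>r m. regs r \<and> m = m0 \<and> r R_x = n + 1 \<and> r R_cur = n)"
proof -
  define I where "I j r m \<longleftrightarrow> m = m0 \<and> r R_zero = 0 \<and> r R_one = 1 \<and> r R_n = n \<and>
    r R_rows = 1 + j \<and> r R_k = (\<Sum>i<j. m0 (1 + i)) \<and> r R_bits = j * n \<and> r R_v = n - j" for j r m
  have "runs read_input (\<lambda>_. 0) m0 (4 + ((n * (5 + 1) + 1) + 5))
      (\<lambda>r m. regs r \<and> m = m0 \<and> r R_x = n + 1 \<and> r R_cur = n)"
    unfolding read_input_def
  proof (rule runs_Seq3)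
    show "runs (Const R_one 1 ;; Load R_n R_zero ;; Copy R_rows R_one ;; Copy R_v R_n) (\<lambda>_. 0) m0 4 (I 0)"
      by (intro runs_eff) (auto simp: I_def size)
  next
    fix r m assume "I 0 r m"
    then show "runs (WhileNZ R_v (Load R_s R_rows ;; Add R_k R_k R_s ;; Inc R_rows ;;
        Add R_bits R_bits R_n ;; Dec R_v)) r m (n * (5 + 1) + 1) (I n)"
      by (rule runs_countdown[where I = I]) (simp add: I_def, intro runs_eff, auto simp: I_def)
  next
    fix r m assume I: "I n r m"
    then have "r R_zero = 0" "r R_one = 1" "r R_n = n" "r R_k = k" "r R_rows = n + 1"
      "r R_bits = n * n" "m = m0"
      using k by (simp_all add: I_def)
    then show "runs (Add R_bits R_bits R_rows ;; Add R_cls R_bits R_rows ;; Add R_leaf R_rows R_one ;;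
      Copy R_cur R_n ;; Copy R_x R_rows) r m 5
      (\<lambda>r m. regs r \<and> m = m0 \<and> r R_x = n + 1 \<and> r R_cur = n)"
      by (intro runs_eff) (simp_all add: regs_def bits_def classes_def)
  qed
  then show ?thesis by (rule runs_mono) simp_all
qed

definition object_order :: "nat list" where
  "object_order = filter (\<lambda>i. m0 (1 + i) = 1) [0..<n] @ filter (\<lambda>i. m0 (1 + i) = 0) [0..<n]"

definition vertex_order :: "nat set \<Rightarrow> nat list" where
  "vertex_order D = filter (\<lambda>v. weight D v = 0) [0..<n] @ filter (\<lambda>v. weight D v = 1) [0..<n] @
     filter (\<lambda>v. weight D v = n + 2) [0..<n]"

lemma distinct_object_order: "distinct object_order"
  by (auto simp: object_order_def)

lemma set_object_order: "set object_order = {..<n}"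
proof -
  have "m0 (Suc i) = Suc 0" if "i < n" "0 < m0 (Suc i)" for i using vals[of i] that by auto
  then show ?thesis by (auto simp: object_order_def)
qed

lemma length_object_order: "length object_order = n"
  using distinct_card[OF distinct_object_order] set_object_order by simp

lemma distinct_vertex_order: "distinct (vertex_order D)"
  by (auto simp: vertex_order_def)

lemma set_vertex_order: "set (vertex_order D) = {..<n}"
  by (auto simp: vertex_order_def weight_def)

lemma length_vertex_order: "length (vertex_order D) = n"
  using distinct_card[OF distinct_vertex_order] set_vertex_order by simp

lemma runs_output_allocation:
  assumes "regs r" "mem D m"
  shows "runs output_allocation r m (eval_time n + 5 * (n * 13 + 4) + (n * 7 + 2) + 20)
    (\<lambda>r' m'. \<forall>j<n. m' (vertex_order D ! j) = object_order ! j)"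
proof -
  define q where "q = classes + n"
  define G where "G m' \<longleftrightarrow> (\<forall>i<n. m' (1 + i) = m0 (1 + i)) \<and> (\<forall>v<n. m' (classes + v) = weight D v)"
    for m'
  \<comment> \<open>\<open>ys\<close> is what has been written from \<open>q\<close> on so far;
    \<open>b\<close> is arbitrary until \<open>R_by\<close> receives the start of the vertex
    list.\<close>
  define St where "St b ys r' m' \<longleftrightarrow> regs r' \<and> r' R_best = q \<and> r' R_by = b \<and> G m' \<and>
    r' R_pc = q + length ys \<and> holds_list m' q ys" for b ys r' m'
  \<comment> \<open>Serves all five passes, which differ only in the wanted value and in the
    source.\<close>
  have step: "runs (p ;; collect src) r1 m1 (1 + (n * 13 + 4))
      (St b (ys @ filter (\<lambda>i. g i = w) [0..<n]))"
    if S: "St b ys r1 m1"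
      and p: "loop_free p" "cost p = 1" "eff p (r1, m1) = (r1(R_w := w), m1)"
      and g: "src = R_one \<and> g = (\<lambda>i. m0 (1 + i)) \<or> src = R_cls \<and> g = weight D"
    for p src r1 m1 b ys g w
  proof (rule runs_Seq)
    show "runs p r1 m1 1 (\<lambda>r m. r = r1(R_w := w) \<and> m = m1)"
      using p by (intro runs_eff) simp_all
  next
    fix r2 m2 assume 2: "r2 = r1(R_w := w) \<and> m2 = m1"
    have r2: "regs r2" "r2 R_best = q" "r2 R_by = b" "G m2" "r2 R_pc = q + length ys"
        "holds_list m2 q ys" "r2 R_w = w"
      using 2 S by (auto simp: St_def intro: regs_cong)
    have src: "r2 src + n \<le> r2 R_pc" "src < R_acc"
      using r2 g by (auto simp: regs_def q_def classes_def bits_def)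
    have key: "m2 (r2 src + i) = g i" if "i < n" for i
      using r2 g that by (auto simp: regs_def G_def)
    then have xs: "filter (\<lambda>i. m2 (r2 src + i) = r2 R_w) [0..<n] = filter (\<lambda>i. g i = w) [0..<n]"
      using r2 by (intro filter_cong) auto
    show "runs (collect src) r2 m2 (n * 13 + 4) (St b (ys @ filter (\<lambda>i. g i = w) [0..<n]))"
    proof (rule runs_mono[OF runs_collect[where N = n]])
      fix r3 m3 assume "let xs = filter (\<lambda>i. m2 (r2 src + i) = r2 R_w) [0..<n] in
        holds_list m3 (r2 R_pc) xs \<and> r3 R_pc = r2 R_pc + length xs \<and> (\<forall>i<r2 R_pc. m3 i = m2 i) \<and>
        (\<forall>a<R_acc. r3 a = r2 a)"
      then have 3: "holds_list m3 (q + length ys) (filter (\<lambda>i. g i = w) [0..<n])"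
        "r3 R_pc = q + length ys + length (filter (\<lambda>i. g i = w) [0..<n])"
        "\<forall>i<q + length ys. m3 i = m2 i" "\<forall>a<R_acc. r3 a = r2 a"
        using r2 unfolding xs Let_def by simp_all
      have "holds_list m3 q ys" by (rule holds_list_cong[OF r2(6)]) (use 3 in simp)
      moreover have "G m3" using 3 r2(4) by (simp add: G_def q_def classes_def bits_def)
      moreover have "regs r3" by (rule regs_cong[OF r2(1)]) (use 3 in simp)
      ultimately show "St b (ys @ filter (\<lambda>i. g i = w) [0..<n]) r3 m3"
        using 3 r2 by (simp add: St_def holds_list_append)
    qed (use r2 src in \<open>simp_all add: regs_def\<close>)
  qed
  have "runs output_allocation r m
    (eval_time n + (2 + ((1 + (n * 13 + 4)) + ((1 + (n * 13 + 4)) + (1 + ((1 + (n * 13 + 4)) +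
      ((1 + (n * 13 + 4)) + ((1 + (n * 13 + 4)) + (n * 7 + 2)))))))))
    (\<lambda>r' m'. \<forall>j<n. m' (vertex_order D ! j) = object_order ! j)"
    unfolding output_allocation_def
  proof (rule runs_Seq3)
    show "runs evaluate r m (eval_time n) (\<lambda>r' m'. regs r' \<and> G m')"
    proof (rule runs_mono[OF runs_evaluate[OF assms]])
      fix r' m' assume a: "r' R_acc = score k D \<and> (\<forall>a<R_acc. r' a = r a) \<and>
        (\<forall>i. i < classes \<or> classes + n \<le> i \<longrightarrow> m' i = m i) \<and> (\<forall>v<n. m' (classes + v) = weight D v)"
      then have "regs r'" by (intro regs_cong[OF assms(1)]) simp
      moreover have "G m'" using a assms(2) by (simp add: G_def mem_def classes_def bits_def)
      ultimately show "regs r' \<and> G m'" ..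
    qed simp
  next
    fix r1 m1 assume "regs r1 \<and> G m1"
    then show "runs (Add R_best R_cls R_n ;; Copy R_pc R_best) r1 m1 2 (\<lambda>r' m'. \<exists>b. St b [] r' m')"
      by (intro runs_eff) (auto simp: St_def holds_list_def regs_def q_def)
  next
    fix r1 m1 assume "\<exists>b. St b [] r1 m1"
    then obtain b where S: "St b [] r1 m1" ..
    show "runs ((Const R_w 1 ;; collect R_one) ;; (Const R_w 0 ;; collect R_one) ;;
        Copy R_by R_pc ;; (Const R_w 0 ;; collect R_cls) ;; (Const R_w 1 ;; collect R_cls) ;;
        (Copy R_w R_leaf ;; collect R_cls) ;; assign) r1 m1
      ((1 + (n * 13 + 4)) + ((1 + (n * 13 + 4)) + (1 + ((1 + (n * 13 + 4)) +
        ((1 + (n * 13 + 4)) + ((1 + (n * 13 + 4)) + (n * 7 + 2)))))))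
      (\<lambda>r' m'. \<forall>j<n. m' (vertex_order D ! j) = object_order ! j)"
    proof (rule runs_Seq3)
      show "runs (Const R_w 1 ;; collect R_one) r1 m1 (1 + (n * 13 + 4))
          (St b ([] @ filter (\<lambda>i. m0 (1 + i) = 1) [0..<n]))"
        by (rule step[OF S]) auto
    next
      fix r2 m2 assume S: "St b ([] @ filter (\<lambda>i. m0 (1 + i) = 1) [0..<n]) r2 m2"
      show "runs (Const R_w 0 ;; collect R_one) r2 m2 (1 + (n * 13 + 4)) (St b object_order)"
        using step[OF S, of "Const R_w 0" 0 R_one "\<lambda>i. m0 (1 + i)"] by (simp add: object_order_def)
    next
      fix r3 m3 assume S: "St b object_order r3 m3"
      \<comment> \<open>The object list has length \<open>n\<close>, so the vertex list starts
        here.\<close>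
      let ?c = "q + n"
      let ?l = "\<lambda>w. filter (\<lambda>v. weight D v = w) [0..<n]"
      show "runs (Copy R_by R_pc ;; (Const R_w 0 ;; collect R_cls) ;; (Const R_w 1 ;; collect R_cls) ;;
          (Copy R_w R_leaf ;; collect R_cls) ;; assign) r3 m3
        (1 + ((1 + (n * 13 + 4)) + ((1 + (n * 13 + 4)) + ((1 + (n * 13 + 4)) + (n * 7 + 2)))))
        (\<lambda>r' m'. \<forall>j<n. m' (vertex_order D ! j) = object_order ! j)"
      proof (rule runs_Seq3)
        show "runs (Copy R_by R_pc) r3 m3 1 (St ?c object_order)"
          using S length_object_order by (intro runs_eff) (auto simp: St_def regs_def)
      next
        fix r4 m4 assume S: "St ?c object_order r4 m4"
        show "runs (Const R_w 0 ;; collect R_cls) r4 m4 (1 + (n * 13 + 4)) (St ?c (object_order @ ?l 0))"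
          by (rule step[OF S]) auto
      next
        fix r5 m5 assume S: "St ?c (object_order @ ?l 0) r5 m5"
        show "runs ((Const R_w 1 ;; collect R_cls) ;; (Copy R_w R_leaf ;; collect R_cls) ;; assign) r5 m5
          ((1 + (n * 13 + 4)) + ((1 + (n * 13 + 4)) + (n * 7 + 2)))
          (\<lambda>r' m'. \<forall>j<n. m' (vertex_order D ! j) = object_order ! j)"
        proof (rule runs_Seq3)
          show "runs (Const R_w 1 ;; collect R_cls) r5 m5 (1 + (n * 13 + 4))
              (St ?c ((object_order @ ?l 0) @ ?l 1))"
            by (rule step[OF S]) auto
        next
          fix r6 m6 assume S: "St ?c ((object_order @ ?l 0) @ ?l 1) r6 m6"
          have "eff (Copy R_w R_leaf) (r6, m6) = (r6(R_w := n + 2), m6)"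
            using S by (simp add: St_def regs_def)
          then show "runs (Copy R_w R_leaf ;; collect R_cls) r6 m6 (1 + (n * 13 + 4))
              (St ?c (((object_order @ ?l 0) @ ?l 1) @ ?l (n + 2)))"
            by (intro step[OF S]) auto
        next
          fix r7 m7 assume "St ?c (((object_order @ ?l 0) @ ?l 1) @ ?l (n + 2)) r7 m7"
          then have S: "St ?c (object_order @ vertex_order D) r7 m7" by (simp add: vertex_order_def)
          show "runs assign r7 m7 (n * 7 + 2) (\<lambda>r' m'. \<forall>j<n. m' (vertex_order D ! j) = object_order ! j)"
            using S length_object_order length_vertex_order[of D] distinct_vertex_order set_vertex_order[of D]
            by (intro runs_assign) (auto simp: St_def regs_def holds_list_append q_def)
        qed
      qed
    qed
  qed
  then show ?thesis by (rule runs_mono) simp_all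
qed

lemma runs_opt_ext_program:
  "runs opt_ext_program (\<lambda>_. 0) m0 (total_time n) (\<lambda>r' m'. \<exists>D. search_path k D \<and> locally_optimal k D \<and>
     (\<forall>j<n. m' (vertex_order D ! j) = object_order ! j))"
  unfolding opt_ext_program_def total_time_def
proof (rule runs_Seq3[OF runs_read_input])
  fix r m assume 1: "regs r \<and> m = m0 \<and> r R_x = n + 1 \<and> r R_cur = n"
  have "mem {} m0" using zeros by (simp add: mem_def bits_def)
  then show "runs local_search r m (((n + 1) * (n + 1) * (n + 2) + n + 1) * (step_time n + 1) + 1)
      (\<lambda>r' m'. regs r' \<and> (\<exists>D. mem D m' \<and> search_path k D \<and> locally_optimal k D))"
    using 1 by (intro runs_local_search) auto
next
  fix r m assume "regs r \<and> (\<exists>D. mem D m \<and> search_path k D \<and> locally_optimal k D)"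
  then obtain D where D: "regs r" "mem D m" "search_path k D" "locally_optimal k D" by auto
  show "runs output_allocation r m (eval_time n + 5 * (n * 13 + 4) + (n * 7 + 2) + 20)
      (\<lambda>r' m'. \<exists>D. search_path k D \<and> locally_optimal k D \<and>
        (\<forall>j<n. m' (vertex_order D ! j) = object_order ! j))"
    by (rule runs_mono[OF runs_output_allocation[OF D(1,2)]]) (use D in auto)
qed

end

section \<open>The approximation guarantee\<close>

text \<open>If the added vertices avoid the leaves of \<open>D\<close>, all these leaves survive. If
  they exhaust the non-leaves, every vertex outside \<open>S\<close> is a leaf of \<open>D\<close>
  and thus of \<open>S\<close>.\<close>

lemma (in finite_graph) card_leaves_fill:
  assumes S: "D \<inter> V \<subseteq> S" "S \<subseteq> V" and fill: "S \<inter> leaves D = {} \<or> V - leaves D \<subseteq> S"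
  shows "min (card V - card S) (card (leaves D)) \<le> card (leaves S)"
  using fill
proof
  assume "S \<inter> leaves D = {}"
  moreover have "\<exists>u\<in>S. adj u v" if "v \<in> leaves D" for v
    using that S(1) adj_V by (auto simp: leaves_def)
  ultimately have "leaves D \<subseteq> leaves S" by (auto simp: leaves_def)
  then have "card (leaves D) \<le> card (leaves S)" by (intro card_mono) auto
  then show ?thesis by simp
next
  assume "V - leaves D \<subseteq> S"
  then have "v \<in> leaves D" if "v \<in> V - S" for v using that by auto
  moreover have "\<exists>u\<in>S. adj u v" if "v \<in> leaves D" for v
    using that S(1) adj_V by (auto simp: leaves_def)
  ultimately have "V - S \<subseteq> leaves S" by (simp add: leaves_def[of S] subset_iff)
  then have "card (V - S) \<le> card (leaves S)" by (intro card_mono) auto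
  then show ?thesis using card_Diff_subset[OF finite_sub_V[OF S(2)] S(2)] by simp
qed

context instance_memory
begin

lemma card_vals_eq_1: "card {i. i < n \<and> m0 (1 + i) = 1} = k"
proof -
  have "k = (\<Sum>i<n. of_bool (m0 (1 + i) = 1))"
    unfolding k using vals by (intro sum.cong) force+
  also have "\<dots> = card {i. i < n \<and> m0 (1 + i) = 1}" by (simp add: sum_of_bool_eq Int_def)
  finally show ?thesis ..
qed

lemma k_le: "k \<le> n"
  using card_vals_eq_1 card_mono[of "{..<n}" "{i. i < n \<and> m0 (1 + i) = 1}"] by auto

lemma object_order_value:
  assumes "j < n"
  shows "m0 (1 + object_order ! j) = 1 \<longleftrightarrow> j < k"
proof -
  let ?ones = "filter (\<lambda>i. m0 (1 + i) = 1) [0..<n]" and ?zeros = "filter (\<lambda>i. m0 (1 + i) = 0) [0..<n]"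
  have len: "length ?ones = k"
  proof -
    have "set ?ones = {i. i < n \<and> m0 (1 + i) = 1}" by auto
    then show ?thesis using card_vals_eq_1 distinct_card[of ?ones] by simp
  qed
  show ?thesis
  proof (cases "j < k")
    case True
    then have "object_order ! j \<in> set ?ones"
      using nth_mem[of j ?ones] len by (simp add: object_order_def nth_append)
    then show ?thesis using True by simp
  next
    case False
    then have "object_order ! j = ?zeros ! (j - k)"
      using len by (simp add: object_order_def nth_append)
    moreover have "j - k < length ?zeros"
      using length_object_order len assms False by (simp add: object_order_def)
    ultimately have "object_order ! j \<in> set ?zeros" using nth_mem by metis
    then show ?thesis using False by simp
  qed
qed

lemma output_bij:
  assumes m: "\<forall>j<n. m (vertex_order D ! j) = object_order ! j"
  shows "bij_betw m {..<n} {..<n}"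
proof -
  have v: "bij_betw ((!) (vertex_order D)) {..<n} {..<n}"
    using bij_betw_nth[OF distinct_vertex_order] length_vertex_order set_vertex_order by metis
  have "bij_betw ((!) object_order) {..<n} {..<n}"
    using bij_betw_nth[OF distinct_object_order] length_object_order set_object_order by metis
  then have "bij_betw (m \<circ> (!) (vertex_order D)) {..<n} {..<n}"
    using m by (subst bij_betw_cong[of _ _ "(!) object_order"]) auto
  then show ?thesis using bij_betw_comp_iff[OF v] by blast
qed

lemma output_ones:
  assumes m: "\<forall>j<n. m (vertex_order D ! j) = object_order ! j"
  shows "{v. v < n \<and> m0 (1 + m v) = 1} = set (take k (vertex_order D))"
proof -
  have "{v. v < n \<and> m0 (1 + m v) = 1} = (\<lambda>j. vertex_order D ! j) ` {j. j < k}"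
  proof (intro equalityI subsetI)
    fix v assume "v \<in> {v. v < n \<and> m0 (1 + m v) = 1}"
    then have v: "v < n" "m0 (1 + m v) = 1" by auto
    then obtain j where j: "j < n" "v = vertex_order D ! j"
      using set_vertex_order[of D] length_vertex_order[of D] by (metis in_set_conv_nth lessThan_iff)
    then show "v \<in> (\<lambda>j. vertex_order D ! j) ` {j. j < k}"
      using v m object_order_value[OF j(1)] by auto
  next
    fix v assume "v \<in> (\<lambda>j. vertex_order D ! j) ` {j. j < k}"
    then obtain j where j: "j < k" "v = vertex_order D ! j" by auto
    then have jn: "j < n" using k_le by simp
    moreover have "v < n"
      using j jn set_vertex_order[of D] length_vertex_order[of D] by (metis lessThan_iff nth_mem)
    ultimately show "v \<in> {v. v < n \<and> m0 (1 + m v) = 1}"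
      using j m object_order_value[OF jn] by auto
  qed
  also have "\<dots> = set (take k (vertex_order D))"
    using k_le length_vertex_order[of D] by (subst nth_image[symmetric]) (auto simp: lessThan_def atLeast0LessThan)
  finally show ?thesis .
qed

text \<open>The value 1 goes to the first \<open>k\<close> vertices in the order. These include all
  vertices of \<open>D\<close>, and the rest is filled up with undominated vertices before any leaf,
  as \<open>card_leaves_fill\<close> requires.\<close>

lemma output_leaves:
  assumes path: "search_path k D" and m: "\<forall>j<n. m (vertex_order D ! j) = object_order ! j"
  shows "min (n - k) (card (leaves D)) \<le> card (leaves {v. v < n \<and> m0 (1 + m v) = 1})"
proof -
  let ?l = "\<lambda>w. filter (\<lambda>v. weight D v = w) [0..<n]"
  let ?S = "set (take k (vertex_order D))"
  have "set (?l 0) = D \<inter> {..<n}" by (auto simp: weight_def)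
  then have len: "length (?l 0) \<le> k"
    using search_path_card[OF path] distinct_card[of "?l 0"] by simp
  have S: "?S = set (?l 0) \<union> set (take (k - length (?l 0)) (?l 1)) \<union>
      set (take (k - length (?l 0) - length (?l 1)) (?l (n + 2)))"
    unfolding vertex_order_def take_append using len by (simp add: Un_assoc del: filter_True filter_False)
  have D: "set (?l 0) = D \<inter> {..<n}" "set (?l 0) \<union> set (?l 1) = {..<n} - leaves D"
    by (auto simp: weight_def leaves_def)
  have card: "card ?S = k"
    using distinct_card[of "take k (vertex_order D)"] distinct_vertex_order[of D]
      length_vertex_order[of D] k_le by simp
  have "?S \<inter> leaves D = {} \<or> {..<n} - leaves D \<subseteq> ?S"
  proof (cases "k \<le> length (?l 0) + length (?l 1)")
    case True
    then have "k - length (?l 0) - length (?l 1) = 0" by simp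
    then have "?S = set (?l 0) \<union> set (take (k - length (?l 0)) (?l 1))" unfolding S by (simp only: take_0) simp
    then have "?S \<subseteq> set (?l 0) \<union> set (?l 1)"
      using set_take_subset[of "k - length (?l 0)" "?l 1"] by blast
    then show ?thesis using D by auto
  next
    case False
    then have "take (k - length (?l 0)) (?l 1) = ?l 1" by simp
    then have "set (?l 0) \<union> set (?l 1) \<subseteq> ?S" unfolding S by (simp only:) blast
    then show ?thesis using D by auto
  qed
  then have "min (card {..<n} - card ?S) (card (leaves D)) \<le> card (leaves ?S)"
  proof (rule card_leaves_fill[rotated 2])
    show "D \<inter> {..<n} \<subseteq> ?S" unfolding S D(1) by blast
    show "?S \<subseteq> {..<n}" using set_take_subset[of k "vertex_order D"] set_vertex_order[of D] by simp
  qed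
  then show ?thesis unfolding card output_ones[OF m] by simp
qed

end

section \<open>From the encoded input to the graph on positions\<close>

lemma length_concat_const:
  "(\<And>xs. xs \<in> set xss \<Longrightarrow> length xs = n) \<Longrightarrow> length (concat xss) = length xss * n"
  by (induction xss) auto

lemma nth_concat_const:
  assumes "\<And>xs. xs \<in> set xss \<Longrightarrow> length xs = n" "u < length xss" "v < n"
  shows "concat xss ! (u * n + v) = xss ! u ! v"
  using assms
proof (induction xss arbitrary: u)
  case (Cons xs xss)
  then show ?case by (cases u) (auto simp: nth_append add.assoc)
qed simp

context
  fixes V :: "'v set" and E and Ob :: "'o set" and val vs os
  assumes inst: "opt_ext_instance V E Ob val" and lists: "listings V Ob vs os"
begin

definition index_adj :: "nat \<Rightarrow> nat \<Rightarrow> bool" where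
  "index_adj u v \<longleftrightarrow> u < length vs \<and> v < length vs \<and> {vs ! u, vs ! v} \<in> E"

definition ones :: nat where
  "ones = (\<Sum>i<length vs. val (os ! i))"

lemma length_os: "length os = length vs"
  using inst lists distinct_card[of vs] distinct_card[of os]
  by (auto simp: opt_ext_instance_def listings_def)

lemma init_memory:
  "snd (init_state (encode_instance E val vs os)) 0 = length vs"
  "i < length vs \<Longrightarrow> snd (init_state (encode_instance E val vs os)) (1 + i) = val (os ! i)"
  "length vs + 1 + length vs * length vs \<le> i \<Longrightarrow> snd (init_state (encode_instance E val vs os)) i = 0"
  "u < length vs \<Longrightarrow> v < length vs \<Longrightarrow>
    snd (init_state (encode_instance E val vs os)) (length vs + 1 + u * length vs + v) =
      of_bool (index_adj u v)"
  "length (encode_instance E val vs os) = length vs + 1 + length vs * length vs"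
proof -
  let ?n = "length vs" and ?x = "encode_instance E val vs os"
  let ?rows = "map (\<lambda>u. map (\<lambda>v. if {u, v} \<in> E then 1 else 0 :: nat) vs) vs"
  have rows: "\<And>xs. xs \<in> set ?rows \<Longrightarrow> length xs = ?n" by auto
  have len: "length (concat ?rows) = ?n * ?n" by (subst length_concat_const[of _ ?n]) auto
  show 5: "length ?x = ?n + 1 + ?n * ?n"
    using len length_os unfolding encode_instance_def by simp
  show "snd (init_state ?x) 0 = ?n" by (simp add: init_state_def encode_instance_def)
  show "snd (init_state ?x) (1 + i) = val (os ! i)" if "i < ?n"
    using that 5 length_os by (simp add: init_state_def) (simp add: encode_instance_def nth_append)
  show "snd (init_state ?x) i = 0" if "?n + 1 + ?n * ?n \<le> i"
    using that 5 by (simp add: init_state_def)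
  show "snd (init_state ?x) (?n + 1 + u * ?n + v) = of_bool (index_adj u v)"
    if uv: "u < ?n" "v < ?n"
  proof -
    have "u * ?n + v < (u + 1) * ?n" using uv by simp
    also have "\<dots> \<le> ?n * ?n" using uv by (intro mult_le_mono1) simp
    finally have "snd (init_state ?x) (?n + 1 + u * ?n + v) = ?x ! (?n + 1 + u * ?n + v)"
      using 5 by (simp add: init_state_def)
    also have "\<dots> = concat ?rows ! (u * ?n + v)"
      using length_os by (simp add: encode_instance_def nth_append)
    also have "\<dots> = ?rows ! u ! v" using uv by (intro nth_concat_const[OF rows]) auto
    also have "\<dots> = of_bool (index_adj u v)" using uv by (simp add: index_adj_def)
    finally show ?thesis .
  qed
qed

lemma instance_memory_init:
  "instance_memory (length vs) index_adj ones (snd (init_state (encode_instance E val vs os)))"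
proof
  show "finite {..<length vs}" by simp
  show "u \<in> {..<length vs}" if "index_adj u v" for u v using that by (simp add: index_adj_def)
  show "index_adj v u" if "index_adj u v" for u v
    using that by (simp add: index_adj_def insert_commute)
  show "\<not> index_adj u u" for u
    using inst by (auto simp: index_adj_def opt_ext_instance_def)
  show "snd (init_state (encode_instance E val vs os)) (1 + i) \<in> {0, 1}" if "i < length vs" for i
    using that init_memory(2)[OF that] inst lists length_os nth_mem[of i os]
    by (simp add: opt_ext_instance_def listings_def)
  show "ones = (\<Sum>i<length vs. snd (init_state (encode_instance E val vs os)) (1 + i))"
    unfolding ones_def using init_memory(2) by (intro sum.cong) auto
qed (use init_memory in auto)

interpretation instance_memory "length vs" index_adj ones
    "snd (init_state (encode_instance E val vs os))"
  by (rule instance_memory_init)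

lemma bij_vs: "bij_betw ((!) vs) {..<length vs} V"
  using lists bij_betw_nth[of vs "{..<length vs}" V] by (simp add: listings_def)

lemma bij_os: "bij_betw ((!) os) {..<length vs} Ob"
  using lists length_os bij_betw_nth[of os "{..<length vs}" Ob] by (simp add: listings_def)

lemma val_01: "x \<in> Ob \<Longrightarrow> val x = 0 \<or> val x = 1"
  using inst by (auto simp: opt_ext_instance_def)

section \<open>Externality as a number of leaves\<close>

text \<open>Values are 0 or 1, so both sides equal the sum of all values.\<close>

lemma allocation_ones:
  assumes "allocation V Ob \<pi>"
  shows "card {i. i < length vs \<and> val (\<pi> (vs ! i)) = 1} = ones"
proof -
  have b: "bij_betw (\<lambda>i. \<pi> (vs ! i)) {..<length vs} Ob"
    using bij_betw_trans[OF bij_vs] assms by (simp add: allocation_def comp_def)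
  have "card {i. i < length vs \<and> val (\<pi> (vs ! i)) = 1} = (\<Sum>i<length vs. of_bool (val (\<pi> (vs ! i)) = 1))"
    by (simp add: sum_of_bool_eq Int_def)
  also have "\<dots> = (\<Sum>i<length vs. val (\<pi> (vs ! i)))"
    using val_01 bij_betwE[OF b] by (intro sum.cong) force+
  also have "\<dots> = (\<Sum>x\<in>Ob. val x)" by (rule sum.reindex_bij_betw[OF b])
  also have "\<dots> = ones" unfolding ones_def by (rule sum.reindex_bij_betw[OF bij_os, symmetric])
  finally show ?thesis .
qed

text \<open>A vertex has externality 1 exactly if it lies outside the set of vertices with value 1
  and is adjacent to it. This reduces the problem to choosing a set with many leaves.\<close>

lemma total_ext_eq_leaves:
  assumes "allocation V Ob \<pi>"
  shows "total_ext V E val \<pi> = card (leaves {i. i < length vs \<and> val (\<pi> (vs ! i)) = 1})"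
proof -
  let ?S = "{i. i < length vs \<and> val (\<pi> (vs ! i)) = 1}"
  have ext: "ext E val \<pi> (vs ! i) = of_bool (i \<in> leaves ?S)" if i: "i < length vs" for i
  proof -
    have "\<pi> (vs ! i) \<in> Ob"
      using i bij_betwE[OF bij_vs] assms by (auto simp: allocation_def bij_betw_def)
    then have 0: "val (\<pi> (vs ! i)) = 0 \<longleftrightarrow> i \<notin> ?S" using i val_01 by fastforce
    have "(\<exists>u. {u, vs ! i} \<in> E \<and> val (\<pi> u) = 1) \<longleftrightarrow> (\<exists>j\<in>?S. index_adj j i)"
    proof
      assume "\<exists>u. {u, vs ! i} \<in> E \<and> val (\<pi> u) = 1"
      then obtain u where u: "{u, vs ! i} \<in> E" "val (\<pi> u) = 1" by auto
      then have "u \<in> V" using inst by (auto simp: opt_ext_instance_def)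
      then obtain j where "j < length vs" "u = vs ! j"
        using bij_vs by (auto simp: bij_betw_def)
      then show "\<exists>j\<in>?S. index_adj j i" using u i by (auto simp: index_adj_def)
    qed (auto simp: index_adj_def)
    then show ?thesis using 0 i by (auto simp: ext_def leaves_def)
  qed
  have "total_ext V E val \<pi> = (\<Sum>i<length vs. ext E val \<pi> (vs ! i))"
    unfolding total_ext_def by (rule sum.reindex_bij_betw[OF bij_vs, symmetric])
  also have "\<dots> = (\<Sum>i<length vs. of_bool (i \<in> leaves ?S))" using ext by (intro sum.cong) auto
  also have "\<dots> = card (leaves ?S)"
  proof -
    have "{..<length vs} \<inter> leaves ?S = leaves ?S" by (auto simp: leaves_def)
    then show ?thesis by (simp add: sum_of_bool_eq)
  qed
  finally show ?thesis .
qed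

lemma total_ext_le: "allocation V Ob \<pi> \<Longrightarrow> total_ext V E val \<pi> \<le> length vs - ones"
proof -
  assume a: "allocation V Ob \<pi>"
  let ?S = "{i. i < length vs \<and> val (\<pi> (vs ! i)) = 1}"
  have "card ?S + card (leaves ?S) \<le> length vs" using card_cover_le[of ?S] by auto
  then show ?thesis using total_ext_eq_leaves[OF a] allocation_ones[OF a] by simp
qed

text \<open>The given allocation makes the range of the maximum non-empty;
  \<open>total_ext_le\<close> makes it finite.\<close>

lemma opt_ext_attained:
  assumes "allocation V Ob \<pi>"
  obtains \<pi>' where "allocation V Ob \<pi>'" "opt_ext V E Ob val = total_ext V E val \<pi>'"
proof -
  let ?X = "{total_ext V E val \<pi> | \<pi>. allocation V Ob \<pi>}"
  have "?X \<subseteq> {..length vs - ones}" using total_ext_le by auto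
  then have "finite ?X" using finite_subset by blast
  moreover have "?X \<noteq> {}" using assms by auto
  ultimately have "Max ?X \<in> ?X" by (rule Max_in)
  then show ?thesis using that by (auto simp: opt_ext_def)
qed

lemma opt_ext_program_correct:
  obtains t r m \<pi> where "exec opt_ext_program (init_state (encode_instance E val vs os)) t (r, m)"
    "t \<le> total_time (length vs)" "encodes_allocation vs os m \<pi>" "allocation V Ob \<pi>"
    "531 / 1000 * real (opt_ext V E Ob val) \<le> real (total_ext V E val \<pi>)"
proof -
  let ?n = "length vs" and ?s = "init_state (encode_instance E val vs os)"
  have s: "?s = ((\<lambda>_. 0), snd ?s)" by (simp add: init_state_def)
  from runs_opt_ext_program obtain t r m D where
    t: "exec opt_ext_program ?s t (r, m)" "t \<le> total_time (length vs)"
    and D: "search_path ones D" "locally_optimal ones D"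
    and m: "\<forall>j<?n. m (vertex_order D ! j) = object_order ! j"
    unfolding runs_def s[symmetric] by blast
  \<comment> \<open>Vertices are mapped back to positions in \<open>vs\<close>, to which
    \<open>m\<close> assigns positions in \<open>os\<close>.\<close>
  define \<pi> where "\<pi> v = os ! m (the_inv_into {..<?n} ((!) vs) v)" for v
  have inj: "inj_on ((!) vs) {..<?n}" using bij_vs by (simp add: bij_betw_def)
  have \<pi>: "\<pi> (vs ! i) = os ! m i" if "i < ?n" for i
    using the_inv_into_f_f[OF inj, of i] that by (simp add: \<pi>_def)
  have bm: "bij_betw m {..<?n} {..<?n}" by (rule output_bij[OF m])
  have enc: "encodes_allocation vs os m \<pi>"
    unfolding encodes_allocation_def using \<pi> bij_betwE[OF bm] length_os by auto
  have "bij_betw (\<pi> \<circ> (!) vs) {..<?n} Ob"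
    using bij_betw_trans[OF bm bij_os] \<pi> by (subst bij_betw_cong[of _ _ "(!) os \<circ> m"]) auto
  then have alloc: "allocation V Ob \<pi>"
    unfolding allocation_def using bij_betw_comp_iff[OF bij_vs] by blast
  have "{v. v < ?n \<and> snd ?s (1 + m v) = 1} = {i. i < ?n \<and> val (\<pi> (vs ! i)) = 1}"
    using \<pi> init_memory(2) bij_betwE[OF bm] by auto
  then have low: "min (?n - ones) (card (leaves D)) \<le> total_ext V E val \<pi>"
    using output_leaves[OF D(1) m] total_ext_eq_leaves[OF alloc] by simp
  obtain \<sigma> where \<sigma>: "allocation V Ob \<sigma>" "opt_ext V E Ob val = total_ext V E val \<sigma>"
    by (rule opt_ext_attained[OF alloc])
  \<comment> \<open>The guaranteed value is a minimum, so the optimum is compared with both terms: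
    by the local search bound for its vertices of value 1, and by the number of vertices of value
    0.\<close>
  have "531 / 1000 * real (total_ext V E val \<sigma>) \<le> real (card (leaves D))"
    unfolding total_ext_eq_leaves[OF \<sigma>(1)]
    using allocation_ones[OF \<sigma>(1)] by (intro local_search_approximation[OF D]) auto
  moreover have "531 / 1000 * real (total_ext V E val \<sigma>) \<le> real (?n - ones)"
    using total_ext_le[OF \<sigma>(1)] by linarith
  ultimately have "531 / 1000 * real (total_ext V E val \<sigma>) \<le> real (min (?n - ones) (card (leaves D)))"
    by (simp add: min_def)
  also have "\<dots> \<le> real (total_ext V E val \<pi>)" using low by (simp only: of_nat_le_iff)
  finally show ?thesis using that[OF t enc alloc] \<sigma>(2) by simp
qed

end

section \<open>Polynomial running time and the final ratio\<close>

lemma total_time_polynomial: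
  "\<exists>b :: nat poly. \<forall>n. total_time n = poly b n"
proof -
  let ?X = "[:0, 1:] :: nat poly"
  let ?e = "?X * (?X * 12 + 30) + 20"
  have "total_time n = poly ((?X * 6 + 10) +
     ((((?X + 1) * (?X + 1) * (?X + 2) + ?X + 1) * (((?X + 1) * (?e + 20) + 20) + 1) + 1) +
      (?e + 5 * (?X * 13 + 4) + (?X * 7 + 2) + 20))) n" for n
  proof -
    have "poly ?X n = n" by simp
    then show ?thesis
      unfolding total_time_def by (simp only: poly_add poly_mult poly_1 poly_numeral)
  qed
  then show ?thesis by blast
qed

text \<open>Coefficients in \<open>nat\<close> are nonnegative. This passes from the number of
  vertices to the length of the input.\<close>

lemma mono_poly_nat: "m \<le> n \<Longrightarrow> poly (b :: nat poly) m \<le> poly b n"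
  by (induction b) (auto intro: add_mono mult_mono)

theorem theorem5:
  "\<exists>p. polynomial_time_on opt_ext_inputs p \<and>
       opt_ext_approximation ((6 * exp 1 - 5) / (6 * exp 1 + 5)) p"
proof (intro exI conjI)
  obtain b :: "nat poly" where b: "\<And>n. total_time n = poly b n"
    using total_time_polynomial by blast
  show "polynomial_time_on opt_ext_inputs opt_ext_program"
    unfolding polynomial_time_on_def
  proof (intro exI[of _ b] ballI)
    fix x assume "x \<in> opt_ext_inputs"
    then obtain V :: "nat set" and E and Ob :: "nat set" and val vs os where
      x: "x = encode_instance E val vs os" and *: "opt_ext_instance V E Ob val" "listings V Ob vs os"
      unfolding opt_ext_inputs_def by blast
    obtain t r m where "exec opt_ext_program (init_state x) t (r, m)" "t \<le> poly b (length vs)"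
      using opt_ext_program_correct[OF *] unfolding b x by metis
    moreover have "poly b (length vs) \<le> poly b (length x)"
      using init_memory(5)[OF *] by (intro mono_poly_nat) (simp add: x)
    ultimately show "\<exists>t s. exec opt_ext_program (init_state x) t s \<and> t \<le> poly b (length x)"
      by (meson order_trans)
  qed
  show "opt_ext_approximation ((6 * exp 1 - 5) / (6 * exp 1 + 5)) opt_ext_program"
    unfolding opt_ext_approximation_def
  proof (intro allI impI)
    fix V :: "nat set" and E and Ob :: "nat set" and val vs os
    assume *: "opt_ext_instance V E Ob val" "listings V Ob vs os"
    obtain t r m \<pi> where
      r: "exec opt_ext_program (init_state (encode_instance E val vs os)) t (r, m)"
      "encodes_allocation vs os m \<pi>" "allocation V Ob \<pi>"
      "531 / 1000 * real (opt_ext V E Ob val) \<le> real (total_ext V E val \<pi>)"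
      using opt_ext_program_correct[OF *] by metis
    \<comment> \<open>The ratio increases with \<open>exp 1\<close>, and at 2.72 it is 11.32 /
      21.32, just below 0.531.\<close>
    have "(6 * exp 1 - 5) / (6 * exp 1 + 5) \<le> (531 / 1000 :: real)"
      using e_less_272 by (simp add: pos_divide_le_eq add_pos_pos)
    then have "(6 * exp 1 - 5) / (6 * exp 1 + 5) * real (opt_ext V E Ob val) \<le>
        531 / 1000 * real (opt_ext V E Ob val)"
      by (rule mult_right_mono) simp
    then show "\<exists>t r m \<pi>. exec opt_ext_program (init_state (encode_instance E val vs os)) t (r, m) \<and>
        encodes_allocation vs os m \<pi> \<and> allocation V Ob \<pi> \<and>
        (6 * exp 1 - 5) / (6 * exp 1 + 5) * real (opt_ext V E Ob val) \<le> real (total_ext V E val \<pi>)"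
      using r by (meson order_trans)
  qed
qed

end
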